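(* There exists an invertible measure-preserving transformation $T$ of a nonatomic $\sigma$-finite infinite standard Borel measure space $(X,\mathcal S,\mu)$ which is rigid and weak doubly ergodic, but such that $T\times T$ is not ergodic (with respect to $\mu\times\mu$).
   Context: A transformation $R$ is ergodic if every invariant measurable set is null or has null complement. $T$ is weak doubly ergodic if for every pair of measurable sets $A,B$ of positive measure there is a positive integer $n$ with $\mu(A\cap T^{-n}A)>0$ and $\mu(B\cap T^{-n}A)>0$. For $0<\rho\le 1$, $T$ is at least $\rho$-partially rigid if for every measurable set $A$ of finite measure there is a sequence of integers $n_m\to\infty$ with $\lim_{m\to\infty}\mu(A\cap T^{n_m}A)\ge\rho\,\mu(A)$. $T$ is rigid if this holds with $\rho=1$. *)

theory Defs
  imports "HOL-Analysis.Analysis"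
begin

definition standard_borel :: "'a measure \<Rightarrow> bool" where
  "standard_borel M \<longleftrightarrow>
     (\<exists>X. topspace X = space M \<and> completely_metrizable_space X \<and> separable_space X \<and>
          sets M = sigma_sets (space M) {U. openin X U})"

definition nonatomic :: "'a measure \<Rightarrow> bool" where
  "nonatomic M \<longleftrightarrow>
     (\<forall>A\<in>sets M. emeasure M A > 0 \<longrightarrow>
        (\<exists>B\<in>sets M. B \<subseteq> A \<and> 0 < emeasure M B \<and> emeasure M B < emeasure M A))"

definition measure_preserving :: "'a measure \<Rightarrow> ('a \<Rightarrow> 'a) \<Rightarrow> bool" where
  "measure_preserving M T \<longleftrightarrow>
     T \<in> M \<rightarrow>\<^sub>M M \<and> (\<forall>A\<in>sets M. emeasure M (T -` A \<inter> space M) = emeasure M A)"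

definition invertible_measure_preserving :: "'a measure \<Rightarrow> ('a \<Rightarrow> 'a) \<Rightarrow> bool" where
  "invertible_measure_preserving M T \<longleftrightarrow>
     measure_preserving M T \<and> bij_betw T (space M) (space M) \<and>
     inv_into (space M) T \<in> M \<rightarrow>\<^sub>M M"

definition ergodic :: "'a measure \<Rightarrow> ('a \<Rightarrow> 'a) \<Rightarrow> bool" where
  "ergodic M R \<longleftrightarrow>
     (\<forall>A\<in>sets M. R -` A \<inter> space M = A \<longrightarrow> A \<in> null_sets M \<or> space M - A \<in> null_sets M)"

definition weak_doubly_ergodic :: "'a measure \<Rightarrow> ('a \<Rightarrow> 'a) \<Rightarrow> bool" where
  "weak_doubly_ergodic M T \<longleftrightarrow>
     (\<forall>A\<in>sets M. \<forall>B\<in>sets M. emeasure M A > 0 \<longrightarrow> emeasure M B > 0 \<longrightarrow>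
        (\<exists>n::nat. n > 0 \<and>
           emeasure M (A \<inter> ((T ^^ n) -` A \<inter> space M)) > 0 \<and>
           emeasure M (B \<inter> ((T ^^ n) -` A \<inter> space M)) > 0))"

text \<open>Meant for \<open>0 < \<rho> \<le> 1\<close> and invertible \<open>T\<close>, so that the images \<open>(T ^^ n) ` A\<close> are
  measurable. An integer sequence tending to infinity is eventually nonnegative, hence the
  exponents are taken in \<^typ>\<open>nat\<close>.\<close>

definition partially_rigid :: "real \<Rightarrow> 'a measure \<Rightarrow> ('a \<Rightarrow> 'a) \<Rightarrow> bool" where
  "partially_rigid \<rho> M T \<longleftrightarrow>
     (\<forall>A\<in>sets M. emeasure M A < \<infinity> \<longrightarrow>
        (\<exists>(n :: nat \<Rightarrow> nat) l. filterlim n at_top sequentially \<and>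
           (\<lambda>m. measure M (A \<inter> (T ^^ n m) ` A)) \<longlonglongrightarrow> l \<and> l \<ge> \<rho> * measure M A))"

definition rigid :: "'a measure \<Rightarrow> ('a \<Rightarrow> 'a) \<Rightarrow> bool" where
  "rigid M T \<longleftrightarrow> partially_rigid 1 M T"

end

theory Submission
  imports Defs
begin

text \<open>
  \<open>T\<close> is a rank-one cutting-and-stacking map of the line. Column \<open>n\<close> has its levels at the integer
  heights \<open>-g \<le> f < g\<close>; every level is cut into pieces that reappear in column \<open>n + 1\<close> at height
  \<open>f + c\<close>, where the offset \<open>c\<close> is \<^emph>\<open>plain\<close> (a multiple of a large number \<open>G\<close>) except for a
  proportion \<open>2 / (n + 6)\<close> of \<^emph>\<open>special\<close> pieces, half of them spaced by \<open>H = 8 g\<close> and half by \<open>H + 1\<close>.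

  Rigidity: \<open>T\<^sup>G\<close> moves nearly every piece of a level into the same level, because the plain pieces
  fill nearly all of it.

  Weak double ergodicity: the proportions of special pieces have a divergent sum, so almost every
  point is special infinitely often. Two sets that are dense in levels with height difference \<open>j\<close>
  are therefore both dense in one common block of special pieces, and there, for \<open>j > 0\<close>,
  \<open>T ^ (j (H + 1))\<close> shifts the second half by \<open>j\<close> pieces while it shifts the first half by \<open>j\<close>
  pieces and changes the height by \<open>j\<close>.

  Non-ergodicity of \<open>T \<times> T\<close>: the squares of the proportions have sum less than 1, so a set of
  positive measure of pairs never has both coordinates special at the same stage. For such pairs the
  differences of the offsets are so far apart that the difference of the heights in column \<open>n + 1\<close>
  determines the one in column \<open>n\<close>. As \<open>T \<times> T\<close> eventually preserves the difference of the
  heights, the difference in column \<open>0\<close> cannot change along an orbit.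
\<close>

section \<open>Cutting and stacking parameters\<close>

text \<open>The recursion is \<open>2 * cuts n * gap n\<close> written out, see
  \<open>half_height_Suc_eq\<close>. Plain offsets stay below \<open>cuts n * gap n\<close>, so the
  new column holds every copy of the old one with room to spare.\<close>

primrec half_height :: "nat \<Rightarrow> int" where
  "half_height 0 = 1"
| "half_height (Suc n) = 2560 * (int n + 6) * half_height n ^ 3"

definition heights :: "nat \<Rightarrow> int set" where
  "heights n = {- half_height n..<half_height n}"

definition cuts :: "nat \<Rightarrow> int" where
  "cuts n = (int n + 6) * (4 * half_height n)"

definition plain :: "nat \<Rightarrow> int" where
  "plain n = (int n + 4) * (4 * half_height n)"

text \<open>Special offsets grow to about \<open>64 * half_height n ^ 2\<close>. The constant 320
  makes the gap exceed twice any of them with a margin, so the small sums of offsets compared below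
  cannot imitate a nonzero multiple of the gap.\<close>

definition gap :: "nat \<Rightarrow> int" where
  "gap n = 320 * half_height n ^ 2"

text \<open>The term \<open>t + 4 * half_height n\<close> makes the spacing \<open>8 * half_height n + 1\<close> in the second half of
  the special pieces and keeps the two halves apart.\<close>

definition special_offset :: "nat \<Rightarrow> int \<Rightarrow> int" where
  "special_offset n t = (t + 1) * (8 * half_height n) + (if t < 4 * half_height n then 0 else t + 4 * half_height n)"

text \<open>The special pieces are numbered after the plain ones, but in height their copies all lie
  between the plain copies 0 and 1.\<close>

definition offset :: "nat \<Rightarrow> int \<Rightarrow> int" where
  "offset n k = (if k < plain n then k * gap n else special_offset n (k - plain n))"

section \<open>Bounds and separation of the offsets\<close>

lemma half_height_ge_1: "1 \<le> half_height n"
proof (induction n)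
  case (Suc n)
  have "1 \<le> half_height n ^ 3" using Suc by (simp add: one_le_power)
  then have "1 * 1 \<le> (2560 * (int n + 6)) * half_height n ^ 3" by (intro mult_mono) auto
  then show ?case by simp
qed simp

lemma cuts_eq: "cuts n = plain n + 8 * half_height n"
  by (simp add: cuts_def plain_def algebra_simps)

lemma plain_ge: "16 * half_height n \<le> plain n"
  using mult_right_mono[of 4 "int n + 4" "4 * half_height n"] half_height_ge_1[of n] by (simp add: plain_def)

lemma cuts_pos: "0 < cuts n"
  using plain_ge[of n] half_height_ge_1[of n] by (simp add: cuts_eq)

lemma half_height_le_sq: "half_height n \<le> half_height n ^ 2"
  using half_height_ge_1[of n] by (simp add: power2_eq_square)

lemma special_offset_ge: "0 \<le> t \<Longrightarrow> 8 * half_height n \<le> special_offset n t"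
  using mult_right_mono[of 1 "t + 1" "8 * half_height n"] half_height_ge_1[of n]
  unfolding special_offset_def by (split if_split, intro conjI impI; linarith)

lemma special_offset_le:
  assumes "0 \<le> t" "t < 8 * half_height n"
  shows "2 * special_offset n t + 16 * half_height n \<le> gap n"
proof -
  have "(t + 1) * (8 * half_height n) \<le> (8 * half_height n) * (8 * half_height n)"
    using assms half_height_ge_1[of n] by (intro mult_right_mono) auto
  then have "special_offset n t \<le> 64 * half_height n ^ 2 + 12 * half_height n"
    using assms half_height_ge_1[of n] unfolding special_offset_def power2_eq_square
    by (split if_split, intro conjI impI; linarith)
  then show ?thesis using half_height_le_sq[of n] half_height_ge_1[of n] unfolding gap_def by linarith
qed

lemma special_offset_sep_less:
  assumes "0 \<le> s" "s < t"
  shows "special_offset n s + 8 * half_height n \<le> special_offset n t"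
proof -
  have "(s + 1 + 1) * (8 * half_height n) \<le> (t + 1) * (8 * half_height n)"
    using assms half_height_ge_1[of n] by (intro mult_right_mono) auto
  moreover have "(s + 1 + 1) * (8 * half_height n) = (s + 1) * (8 * half_height n) + 8 * half_height n"
    by (simp add: algebra_simps)
  ultimately show ?thesis using assms half_height_ge_1[of n] unfolding special_offset_def
    by (cases "s < 4 * half_height n"; cases "t < 4 * half_height n"; simp only: if_True if_False; linarith)
qed

lemma special_offset_sep:
  assumes "0 \<le> s" "0 \<le> t" "s \<noteq> t"
  shows "8 * half_height n \<le> \<bar>special_offset n s - special_offset n t\<bar>"
  using special_offset_sep_less[of s t n] special_offset_sep_less[of t s n] assms by linarith

text \<open>A normal form for both kinds of pieces: a multiple of the gap plus a remainder. The
  bound on the remainder leaves room for two remainders and a tolerance below one gap, which is what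
  \<open>multiple_small\<close> asks for.\<close>

lemma offset_decomp:
  assumes "k \<in> {0..<cuts n}"
  obtains a s where "offset n k = a * gap n + s"
    "k < plain n \<and> a = k \<and> s = 0 \<or>
     plain n \<le> k \<and> a = 0 \<and> s = special_offset n (k - plain n) \<and> 8 * half_height n \<le> s \<and> 2 * s + 16 * half_height n \<le> gap n"
proof (cases "k < plain n")
  case True
  then show ?thesis using that[of k 0] by (simp add: offset_def)
next
  case False
  then show ?thesis
    using that[of 0 "special_offset n (k - plain n)"] assms
      special_offset_ge[of "k - plain n" n] special_offset_le[of "k - plain n" n]
    by (simp add: offset_def cuts_eq)
qed

lemma multiple_small:
  fixes a G d :: int
  assumes "\<bar>a * G + d\<bar> < e" "\<bar>d\<bar> + e \<le> G"
  shows "a = 0"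
proof (rule ccontr)
  assume "a \<noteq> 0"
  then have "1 \<le> \<bar>a\<bar>" by simp
  moreover have "0 \<le> G" using assms by linarith
  ultimately have "G \<le> \<bar>a * G\<bar>" by (simp add: abs_mult mult_le_cancel_right1)
  then show False using assms by linarith
qed

lemma offset_sep:
  assumes "k \<in> {0..<cuts n}" "l \<in> {0..<cuts n}" "\<bar>offset n k - offset n l\<bar> < 8 * half_height n"
  shows "k = l"
proof -
  obtain a s where k: "offset n k = a * gap n + s"
    "k < plain n \<and> a = k \<and> s = 0 \<or>
     plain n \<le> k \<and> a = 0 \<and> s = special_offset n (k - plain n) \<and> 8 * half_height n \<le> s \<and> 2 * s + 16 * half_height n \<le> gap n"
    using offset_decomp[OF assms(1)] by metis
  obtain b t where l: "offset n l = b * gap n + t"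
    "l < plain n \<and> b = l \<and> t = 0 \<or>
     plain n \<le> l \<and> b = 0 \<and> t = special_offset n (l - plain n) \<and> 8 * half_height n \<le> t \<and> 2 * t + 16 * half_height n \<le> gap n"
    using offset_decomp[OF assms(2)] by metis
  have g: "8 * half_height n \<le> gap n" using half_height_le_sq[of n] half_height_ge_1[of n] unfolding gap_def by linarith
  have small: "\<bar>(a - b) * gap n + (s - t)\<bar> < 8 * half_height n"
    using assms(3) k(1) l(1) by (simp add: algebra_simps)
  have "\<bar>s - t\<bar> + 8 * half_height n \<le> gap n" using k l g half_height_ge_1[of n] by linarith
  from multiple_small[OF small this] have ab: "a = b" by simp
  then have st: "\<bar>s - t\<bar> < 8 * half_height n" using small by simp
  show ?thesis
    using k(2) l(2) ab st special_offset_sep[of "k - plain n" "l - plain n" n] half_height_ge_1[of n]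
    by force
qed

text \<open>The arithmetic core of non-ergodicity. Two special pieces in one pair would break it:
  neighbours in the two halves have differences \<open>8 * half_height n\<close> and
  \<open>8 * half_height n + 1\<close>, which are close but distinct.\<close>

lemma good_difference_eq:
  assumes "k \<in> {0..<cuts n}" "k' \<in> {0..<cuts n}" "l \<in> {0..<cuts n}" "l' \<in> {0..<cuts n}"
    and "k < plain n \<or> k' < plain n" "l < plain n \<or> l' < plain n"
    and "\<bar>(offset n k - offset n k') - (offset n l - offset n l')\<bar> < 4 * half_height n"
  shows "offset n k - offset n k' = offset n l - offset n l'"
proof -
  note dec = offset_decomp[where n = n]
  obtain a s where k: "offset n k = a * gap n + s"
    "k < plain n \<and> a = k \<and> s = 0 \<or>
     plain n \<le> k \<and> a = 0 \<and> s = special_offset n (k - plain n) \<and> 8 * half_height n \<le> s \<and> 2 * s + 16 * half_height n \<le> gap n"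
    using dec[OF assms(1)] by metis
  obtain a' s' where k': "offset n k' = a' * gap n + s'"
    "k' < plain n \<and> a' = k' \<and> s' = 0 \<or>
     plain n \<le> k' \<and> a' = 0 \<and> s' = special_offset n (k' - plain n) \<and> 8 * half_height n \<le> s' \<and> 2 * s' + 16 * half_height n \<le> gap n"
    using dec[OF assms(2)] by metis
  obtain b t where l: "offset n l = b * gap n + t"
    "l < plain n \<and> b = l \<and> t = 0 \<or>
     plain n \<le> l \<and> b = 0 \<and> t = special_offset n (l - plain n) \<and> 8 * half_height n \<le> t \<and> 2 * t + 16 * half_height n \<le> gap n"
    using dec[OF assms(3)] by metis
  obtain b' t' where l': "offset n l' = b' * gap n + t'"
    "l' < plain n \<and> b' = l' \<and> t' = 0 \<or>
     plain n \<le> l' \<and> b' = 0 \<and> t' = special_offset n (l' - plain n) \<and> 8 * half_height n \<le> t' \<and> 2 * t' + 16 * half_height n \<le> gap n"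
    using dec[OF assms(4)] by metis
  have small: "\<bar>(a - a' - b + b') * gap n + (s - s' - t + t')\<bar> < 4 * half_height n"
    using assms(7) k(1) k'(1) l(1) l'(1) by (simp add: algebra_simps)
  have g: "16 * half_height n \<le> gap n" using half_height_le_sq[of n] half_height_ge_1[of n] unfolding gap_def by linarith
  have "\<bar>s - s' - t + t'\<bar> + 4 * half_height n \<le> gap n"
    using k(2) k'(2) l(2) l'(2) assms(5,6) g half_height_ge_1[of n] by linarith
  from multiple_small[OF small this] have z: "a - a' - b + b' = 0" .
  then have st: "\<bar>s - s' - t + t'\<bar> < 4 * half_height n" using small by simp
  have S: "special_offset n (u - plain n) = special_offset n (v - plain n)"
    if "\<bar>special_offset n (u - plain n) - special_offset n (v - plain n)\<bar> < 4 * half_height n"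
      "plain n \<le> u" "plain n \<le> v" for u v
    using special_offset_sep[of "u - plain n" "v - plain n" n] that half_height_ge_1[of n] by force
  \<comment> \<open>Each pair has at most one nonzero remainder, and it is at least
    \<open>8 * half_height n\<close>. A small total forces cancellation of \<open>s\<close> against
    \<open>t\<close> or of \<open>s'\<close> against \<open>t'\<close>, and separated special
    offsets that nearly agree are equal.\<close>
  have "s - s' - t + t' = 0"
    using assms(5,6) k(2) k'(2) l(2) l'(2) st half_height_ge_1[of n] S[of k l] S[of l' k'] by auto
  moreover have "offset n k - offset n k' - (offset n l - offset n l') =
      (a - a' - b + b') * gap n + (s - s' - t + t')"
    using k(1) k'(1) l(1) l'(1) by (simp add: algebra_simps)
  ultimately show ?thesis using z by simp
qed

lemma half_height_Suc_eq: "half_height (Suc n) = 2 * cuts n * gap n"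
  by (simp add: cuts_def gap_def power2_eq_square power3_eq_cube algebra_simps)

lemma gap_ge: "320 * half_height n \<le> gap n"
  using half_height_le_sq[of n] by (simp add: gap_def)

lemma offset_bounds:
  assumes "k \<in> {0..<cuts n}"
  shows "0 \<le> offset n k" "offset n k + half_height n < half_height (Suc n)"
proof -
  have g: "1 \<le> half_height n" "320 * half_height n \<le> gap n" by (rule half_height_ge_1 gap_ge)+
  have "1 * gap n \<le> cuts n * gap n" using cuts_pos[of n] g by (intro mult_right_mono) auto
  moreover have "k * gap n \<le> cuts n * gap n" using assms g by (intro mult_right_mono) auto
  moreover have "0 \<le> k * gap n" using assms g by simp
  moreover obtain a s where "offset n k = a * gap n + s"
    "a = k \<and> s = 0 \<or> a = 0 \<and> 8 * half_height n \<le> s \<and> 2 * s + 16 * half_height n \<le> gap n"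
    using offset_decomp[OF assms] by metis
  ultimately have "0 \<le> offset n k \<and> offset n k + half_height n < 2 * (cuts n * gap n)"
    using g by (elim disjE conjE; hypsubst; simp only: mult_zero_left; linarith)
  then show "0 \<le> offset n k" "offset n k + half_height n < half_height (Suc n)" by (auto simp: half_height_Suc_eq simp del: half_height.simps)
qed

text \<open>The spare level above and below each copy guarantees that a point of column
  \<open>n\<close> is neither in the top nor in the bottom level one stage later.\<close>

lemma offset_heights:
  assumes "f \<in> heights n" "k \<in> {0..<cuts n}"
  shows "f + offset n k \<in> heights (Suc n)" "f + offset n k + 1 \<in> heights (Suc n)"
    "f + offset n k - 1 \<in> heights (Suc n)"
  using offset_bounds[OF assms(2)] assms half_height_ge_1[of n] gap_ge[of n]
    mult_right_mono[of 1 "2 * cuts n" "gap n"] cuts_pos[of n]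
  by (auto simp: heights_def half_height_Suc_eq simp del: half_height.simps)

lemma offset_inj:
  assumes "f \<in> heights n" "f' \<in> heights n" "k \<in> {0..<cuts n}" "k' \<in> {0..<cuts n}"
    and "f + offset n k = f' + offset n k'"
  shows "f = f' \<and> k = k'"
proof -
  have "k = k'" using assms(1,2,5) half_height_ge_1[of n]
    by (intro offset_sep[OF assms(3,4)]) (auto simp: heights_def)
  then show ?thesis using assms(5) by simp
qed

text \<open>Column \<open>Suc n\<close> has at least twice as many levels as there are pieces of
  column \<open>n\<close>, so the measure covered at least doubles at each stage.\<close>

lemma cuts_half_height_le: "2 * (cuts n * half_height n) \<le> half_height (Suc n)"
  using mult_left_mono[of "half_height n" "gap n" "2 * cuts n"] gap_ge[of n] half_height_ge_1[of n] cuts_pos[of n]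
  by (simp add: half_height_Suc_eq del: half_height.simps)

section \<open>Arrangement of the levels on the line\<close>

text \<open>Levels are realised as intervals of the line indexed by integers. Interval
  \<open>i\<close> of stage \<open>Suc n\<close> lies in interval \<open>i div cuts n\<close> of
  stage \<open>n\<close> and is its piece number \<open>i mod cuts n\<close>.\<close>

definition copies :: "nat \<Rightarrow> int set" where
  "copies n = {i. i div cuts n \<in> heights n}"

definition copy_heights :: "nat \<Rightarrow> int set" where
  "copy_heights n = (\<lambda>(f, k). f + offset n k) ` (heights n \<times> {0..<cuts n})"

text \<open>The levels of column \<open>Suc n\<close> that are not copies of levels of column \<open>n\<close> are spacers;
  their arrangement on the line does not matter.\<close>

definition spacer :: "nat \<Rightarrow> int \<Rightarrow> int" where
  "spacer n = (SOME e. bij_betw e (heights (Suc n) - copies n) (heights (Suc n) - copy_heights n))"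

text \<open>Translates position on the line into height in the column. The same index set
  \<open>heights n\<close> serves for both, so column \<open>n\<close> always fills an interval
  symmetric about 0.\<close>

primrec place :: "nat \<Rightarrow> int \<Rightarrow> int" where
  "place 0 = (\<lambda>i. i)"
| "place (Suc n) = (\<lambda>i. if i \<in> copies n then place n (i div cuts n) + offset n (i mod cuts n)
     else spacer n i)"

lemma bij_copies:
  "bij_betw (\<lambda>i. (i div cuts n, i mod cuts n)) (copies n) (heights n \<times> {0..<cuts n})"
  by (rule bij_betw_byWitness[where f' = "\<lambda>(f, k). f * cuts n + k"])
    (use cuts_pos[of n] in \<open>auto simp: copies_def\<close>)

lemma bij_copy_heights:
  "bij_betw (\<lambda>(f, k). f + offset n k) (heights n \<times> {0..<cuts n}) (copy_heights n)"
  unfolding bij_betw_def copy_heights_def using offset_inj by (auto simp: inj_on_def)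

lemma copies_subset: "copies n \<subseteq> heights (Suc n)"
proof
  fix i assume "i \<in> copies n"
  then have i: "- half_height n \<le> i div cuts n" "i div cuts n + 1 \<le> half_height n"
    by (auto simp: copies_def heights_def)
  have d: "i = (i div cuts n) * cuts n + i mod cuts n" "0 \<le> i mod cuts n" "i mod cuts n < cuts n"
    using cuts_pos[of n] by auto
  have "(- half_height n) * cuts n \<le> (i div cuts n) * cuts n" "(i div cuts n + 1) * cuts n \<le> half_height n * cuts n"
    using i cuts_pos[of n] by (auto intro!: mult_right_mono simp del: mult_minus_left)
  moreover have "0 < cuts n * half_height n" using cuts_pos[of n] half_height_ge_1[of n] by simp
  moreover have "(i div cuts n + 1) * cuts n = (i div cuts n) * cuts n + cuts n"
    "(- half_height n) * cuts n = - (cuts n * half_height n)" "half_height n * cuts n = cuts n * half_height n"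
    by (simp_all add: algebra_simps)
  ultimately have "- half_height (Suc n) \<le> i" "i < half_height (Suc n)" using cuts_half_height_le[of n] d by linarith+
  then show "i \<in> heights (Suc n)" by (simp add: heights_def)
qed

lemma copy_heights_subset: "copy_heights n \<subseteq> heights (Suc n)"
  using offset_heights(1) by (auto simp: copy_heights_def)

lemma finite_heights [simp]: "finite (heights n)"
  by (simp add: heights_def)

text \<open>Positions and heights of the copies are both counted by pairs of a level and a piece, so
  equally many positions and heights are left over.\<close>

lemma bij_spacer:
  "bij_betw (spacer n) (heights (Suc n) - copies n) (heights (Suc n) - copy_heights n)"
proof -
  have "card (copies n) = card (copy_heights n)"
    using bij_betw_same_card[OF bij_copies[of n]] bij_betw_same_card[OF bij_copy_heights[of n]] by simp
  then have "card (heights (Suc n) - copies n) = card (heights (Suc n) - copy_heights n)"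
    using copies_subset[of n] copy_heights_subset[of n]
    by (simp add: card_Diff_subset finite_subset[OF _ finite_heights])
  then have "\<exists>e. bij_betw e (heights (Suc n) - copies n) (heights (Suc n) - copy_heights n)"
    by (intro finite_same_card_bij) auto
  then show ?thesis unfolding spacer_def by (rule someI_ex)
qed

lemma bij_place: "bij_betw (place n) (heights n) (heights n)"
proof (induction n)
  case (Suc n)
  have 1: "bij_betw (\<lambda>(i, k). (place n i, k)) (heights n \<times> {0..<cuts n}) (heights n \<times> {0..<cuts n})"
    using bij_betw_map_prod[OF Suc bij_betw_id] by (simp add: map_prod_def id_def)
  have "bij_betw ((\<lambda>(f, k). f + offset n k) \<circ> ((\<lambda>(i, k). (place n i, k)) \<circ>
      (\<lambda>i. (i div cuts n, i mod cuts n)))) (copies n) (copy_heights n)"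
    by (intro bij_betw_trans[OF _ bij_copy_heights] bij_betw_trans[OF _ 1] bij_copies)
  then have "bij_betw (place (Suc n)) (copies n) (copy_heights n)"
    by (rule bij_betw_cong[THEN iffD1, rotated]) simp
  moreover have "bij_betw (place (Suc n)) (heights (Suc n) - copies n) (heights (Suc n) - copy_heights n)"
    by (rule bij_betw_cong[THEN iffD1, OF _ bij_spacer]) simp
  ultimately have "bij_betw (place (Suc n)) (copies n \<union> (heights (Suc n) - copies n))
      (copy_heights n \<union> (heights (Suc n) - copy_heights n))"
    by (rule bij_betw_combine) auto
  then show ?case using copies_subset[of n] copy_heights_subset[of n] by (simp add: Un_absorb1)
qed (simp add: bij_betw_def)

section \<open>Coordinates of points: cells, heights and digits\<close>

primrec width :: "nat \<Rightarrow> real" where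
  "width 0 = 1"
| "width (Suc n) = width n / real_of_int (cuts n)"

definition cell :: "nat \<Rightarrow> real \<Rightarrow> int" where
  "cell n x = \<lfloor>x / width n\<rfloor>"

definition height :: "nat \<Rightarrow> real \<Rightarrow> int" where
  "height n x = place n (cell n x)"

text \<open>The mixed-radix digit of \<open>x\<close> that tells into which piece \<open>x\<close>
  falls when its level is cut at stage \<open>n\<close>.\<close>

definition digit :: "nat \<Rightarrow> real \<Rightarrow> int" where
  "digit n x = cell (Suc n) x mod cuts n"

text \<open>The condition on the cell is needed because \<open>place n\<close> is not controlled
  outside \<open>heights n\<close>.\<close>

definition level :: "nat \<Rightarrow> int \<Rightarrow> real set" where
  "level n f = {x. cell n x \<in> heights n \<and> height n x = f}"

definition pos :: "nat \<Rightarrow> int \<Rightarrow> int" where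
  "pos n f = inv_into (heights n) (place n) f"

lemma width_pos: "0 < width n"
  using cuts_pos by (induction n) auto

lemma width_Suc: "width n = real_of_int (cuts n) * width (Suc n)"
  using cuts_pos[of n] by simp

lemma cell_Suc_div: "cell (Suc n) x div cuts n = cell n x"
proof -
  have "x / width (Suc n) / real_of_int (cuts n) = x / width n"
    using cuts_pos[of n] by simp
  then show ?thesis
    using floor_divide_real_eq_div[of "cuts n" "x / width (Suc n)"] cuts_pos[of n]
    by (simp add: cell_def)
qed

lemma digit_range: "digit n x \<in> {0..<cuts n}"
  using cuts_pos[of n] by (simp add: digit_def)

lemma
  assumes "cell n x \<in> heights n"
  shows cell_Suc: "cell (Suc n) x \<in> heights (Suc n)"
    and height_Suc: "height (Suc n) x = height n x + offset n (digit n x)"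
proof -
  have "cell (Suc n) x \<in> copies n" using assms by (simp add: copies_def cell_Suc_div)
  then show "cell (Suc n) x \<in> heights (Suc n)"
    and "height (Suc n) x = height n x + offset n (digit n x)"
    using copies_subset by (auto simp: height_def cell_Suc_div digit_def)
qed

lemma height_in_heights: "cell n x \<in> heights n \<Longrightarrow> height n x \<in> heights n"
  using bij_place[of n] by (auto simp: height_def bij_betw_def)

lemma
  assumes "f \<in> heights n"
  shows pos_in_heights: "pos n f \<in> heights n" and place_pos: "place n (pos n f) = f"
  using assms bij_place[of n] inv_into_into[of f "place n" "heights n"]
    f_inv_into_f[of f "place n" "heights n"]
  by (auto simp: pos_def bij_betw_def)

lemma pos_place: "i \<in> heights n \<Longrightarrow> pos n (place n i) = i"
  using bij_place[of n] by (auto simp: pos_def bij_betw_def)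

text \<open>On the line, refinement is plain subdivision from left to right, whatever happens to the
  heights.\<close>

lemma pos_Suc:
  assumes "f \<in> heights n" "k \<in> {0..<cuts n}"
  shows "pos (Suc n) (f + offset n k) = cuts n * pos n f + k"
proof -
  let ?i = "cuts n * pos n f + k"
  have dm: "?i div cuts n = pos n f" "?i mod cuts n = k"
    using assms(2) cuts_pos[of n] by auto
  have "?i \<in> copies n" using dm pos_in_heights[OF assms(1)] by (simp add: copies_def)
  then have "place (Suc n) ?i = f + offset n k" and "?i \<in> heights (Suc n)"
    using dm place_pos[OF assms(1)] copies_subset[of n] by auto
  then show ?thesis using pos_place[of ?i "Suc n"] by (simp del: place.simps)
qed

lemma level_iff:
  assumes "f \<in> heights n"
  shows "x \<in> level n f \<longleftrightarrow> cell n x = pos n f"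
  using assms pos_place[of "cell n x" n] pos_in_heights[of f n] place_pos[of f n]
  by (auto simp: level_def height_def)

lemma level_eq:
  assumes "f \<in> heights n"
  shows "level n f = {width n * real_of_int (pos n f)..<width n * (real_of_int (pos n f) + 1)}"
  using width_pos[of n]
  by (auto simp: level_iff[OF assms] cell_def floor_eq_iff field_simps)

lemma level_split:
  assumes "f \<in> heights n"
  shows "level n f = (\<Union>k\<in>{0..<cuts n}. level (Suc n) (f + offset n k))"
proof (intro set_eqI iffI)
  fix x assume x: "x \<in> level n f"
  then have "cell n x \<in> heights n" "height n x = f" by (auto simp: level_def)
  then have "x \<in> level (Suc n) (f + offset n (digit n x))"
    using cell_Suc[of n x] height_Suc[of n x] by (simp add: level_def)
  then show "x \<in> (\<Union>k\<in>{0..<cuts n}. level (Suc n) (f + offset n k))"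
    using digit_range by blast
next
  fix x assume "x \<in> (\<Union>k\<in>{0..<cuts n}. level (Suc n) (f + offset n k))"
  then obtain k where k: "k \<in> {0..<cuts n}" "x \<in> level (Suc n) (f + offset n k)" by blast
  then have "cell (Suc n) x = cuts n * pos n f + k"
    using level_iff offset_heights(1)[OF assms k(1)] pos_Suc[OF assms k(1)] by simp
  then have "cell n x = pos n f" using cell_Suc_div[of n x] k(1) cuts_pos[of n] by auto
  then show "x \<in> level n f" by (simp add: level_iff[OF assms])
qed

lemma level_disjoint: "f \<noteq> f' \<Longrightarrow> level n f \<inter> level n f' = {}"
  by (auto simp: level_def)

text \<open>The columns cover growing intervals about 0 and so exhaust the line.\<close>

lemma width_half_height: "2 ^ n \<le> width n * real_of_int (half_height n)"
proof (induction n)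
  case (Suc n)
  have "real_of_int (2 * (cuts n * half_height n)) \<le> real_of_int (half_height (Suc n))"
    using cuts_half_height_le[of n] by (simp only: of_int_le_iff)
  then have "width (Suc n) * (2 * (cuts n * half_height n)) \<le> width (Suc n) * half_height (Suc n)"
    using width_pos[of "Suc n"] by (intro mult_left_mono) auto
  moreover have "width (Suc n) * (2 * (cuts n * half_height n)) = 2 * (width n * half_height n)"
    using cuts_pos[of n] by simp
  ultimately show ?case using Suc unfolding power_Suc by linarith
qed simp

lemma cell_in_heightsI: "\<bar>x\<bar> < 2 ^ n \<Longrightarrow> cell n x \<in> heights n"
  using width_half_height[of n] width_pos[of n]
  by (auto simp: cell_def heights_def le_floor_iff floor_less_iff field_simps)

lemma cell_in_heights_mono:
  assumes "cell m x \<in> heights m" "m \<le> n"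
  shows "cell n x \<in> heights n"
  using assms(2,1) by (induction rule: dec_induct) (auto intro: cell_Suc)

definition inside :: "nat \<Rightarrow> real \<Rightarrow> bool" where
  "inside n x \<longleftrightarrow> cell n x \<in> heights n \<and> height n x + 1 \<in> heights n \<and> height n x - 1 \<in> heights n"

text \<open>Once \<open>x\<close> has entered a column, the margins in \<open>offset_heights\<close>
  keep it away from the top and the bottom at all later stages.\<close>

lemma eventually_inside: "\<forall>\<^sub>F n in sequentially. inside n x"
proof -
  obtain m where m: "\<bar>x\<bar> < 2 ^ m" using real_arch_pow[of 2 "\<bar>x\<bar>"] by auto
  have "inside n x" if mn: "Suc m \<le> n" for n
  proof -
    obtain l where l: "n = Suc l" "m \<le> l" using mn by (cases n) auto
    have "cell l x \<in> heights l" using cell_in_heights_mono[OF cell_in_heightsI[OF m] l(2)] .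
    then show ?thesis
      using offset_heights[OF height_in_heights digit_range, of l x x] cell_Suc[of l x] height_Suc[of l x]
      by (simp add: inside_def l(1))
  qed
  then show ?thesis by (auto simp: eventually_sequentially)
qed

section \<open>The transformation\<close>

definition up :: "nat \<Rightarrow> real \<Rightarrow> bool" where
  "up n x \<longleftrightarrow> cell n x \<in> heights n \<and> height n x + 1 \<in> heights n"

definition shift :: "nat \<Rightarrow> int \<Rightarrow> real" where
  "shift n f = width n * real_of_int (pos n (f + 1) - pos n f)"

text \<open>A level is translated onto the next higher one. The least stage at which this makes
  sense is a mere choice, since all later stages give the same translation.\<close>

definition T :: "real \<Rightarrow> real" where
  "T x = (let n = LEAST n. up n x in x + shift n (height n x))"

text \<open>Two neighbouring levels are cut alike, and pieces with the same number are again
  neighbours. Their positions differ by \<open>cuts n\<close> times the old difference, which the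
  smaller width compensates.\<close>

lemma up_Suc:
  assumes "up n x"
  shows "up (Suc n) x" "shift (Suc n) (height (Suc n) x) = shift n (height n x)"
proof -
  have x: "cell n x \<in> heights n" "height n x + 1 \<in> heights n" using assms by (auto simp: up_def)
  have h: "height n x \<in> heights n" by (rule height_in_heights[OF x(1)])
  have e: "height n x + offset n (digit n x) + 1 = height n x + 1 + offset n (digit n x)" by simp
  show "up (Suc n) x"
    using cell_Suc[OF x(1)] height_Suc[OF x(1)] offset_heights(1)[OF x(2) digit_range, of x]
    by (simp add: up_def algebra_simps)
  show "shift (Suc n) (height (Suc n) x) = shift n (height n x)"
    unfolding shift_def height_Suc[OF x(1)] e pos_Suc[OF h digit_range] pos_Suc[OF x(2) digit_range]
    using cuts_pos[of n] by (simp add: right_diff_distrib)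
qed

lemma up_mono:
  assumes "up m x" "m \<le> n"
  shows "up n x \<and> shift n (height n x) = shift m (height m x)"
  using assms(2,1) by (induction rule: dec_induct) (auto simp: up_Suc)

lemma T_eq:
  assumes "up n x"
  shows "T x = x + shift n (height n x)"
  using up_mono[OF LeastI[of "\<lambda>n. up n x", OF assms] Least_le[of "\<lambda>n. up n x", OF assms]]
  by (simp add: T_def Let_def)

lemma T_on_level:
  assumes "f \<in> heights n" "f + 1 \<in> heights n" "x \<in> level n f"
  shows "T x = x + shift n f"
  using T_eq[of n x] assms by (simp add: level_def up_def)

lemma shift_level_iff:
  assumes "f \<in> heights n" "f + 1 \<in> heights n"
  shows "x + shift n f \<in> level n (f + 1) \<longleftrightarrow> x \<in> level n f"
  using assms by (auto simp: level_eq shift_def algebra_simps)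

lemma T_image_level:
  assumes "f \<in> heights n" "f + 1 \<in> heights n"
  shows "T ` level n f = level n (f + 1)"
proof -
  have "T ` level n f = (\<lambda>x. x + shift n f) ` level n f"
    using T_on_level[OF assms] by (intro image_cong) auto
  also have "\<dots> = level n (f + 1)"
  proof (intro set_eqI iffI)
    fix y assume "y \<in> level n (f + 1)"
    then have "y - shift n f \<in> level n f" using shift_level_iff[OF assms, of "y - shift n f"] by simp
    then show "y \<in> (\<lambda>x. x + shift n f) ` level n f" by (intro image_eqI[of _ _ "y - shift n f"]) auto
  qed (auto simp: shift_level_iff[OF assms])
  finally show ?thesis .
qed

lemma height_T:
  assumes "inside n x"
  shows "cell n (T x) \<in> heights n" "height n (T x) = height n x + 1"
proof -
  have "x \<in> level n (height n x)" using assms by (auto simp: inside_def level_def)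
  then have "T x \<in> level n (height n x + 1)"
    using T_image_level[of "height n x" n] assms height_in_heights[of n x] by (auto simp: inside_def)
  then show "cell n (T x) \<in> heights n" "height n (T x) = height n x + 1" by (auto simp: level_def)
qed

lemma inj_T: "inj T"
proof (rule injI)
  fix x y assume eq: "T x = T y"
  have "\<forall>\<^sub>F n in sequentially. inside n x \<and> inside n y"
    by (intro eventually_conj eventually_inside)
  then obtain n where n: "inside n x" "inside n y" by (auto simp: eventually_sequentially)
  then have "height n x = height n y" using height_T[of n x] height_T[of n y] eq by simp
  moreover have "T x = x + shift n (height n x)" "T y = y + shift n (height n y)"
    using n by (auto intro!: T_eq simp: inside_def up_def)
  ultimately show "x = y" using eq by (metis add_right_cancel)
qed

lemma surj_T: "surj T"
  unfolding surj_def
proof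
  fix y
  obtain n where n: "inside n y" using eventually_inside[of y] by (auto simp: eventually_sequentially)
  let ?f = "height n y - 1"
  have "T ` level n ?f = level n (?f + 1)"
    using n height_in_heights[of n y] by (intro T_image_level) (auto simp: inside_def)
  moreover have "y \<in> level n (?f + 1)" using n by (simp add: inside_def level_def)
  ultimately show "\<exists>x. y = T x" by (metis imageE)
qed

lemma bij_T: "bij T"
  by (simp add: bij_def inj_T surj_T)

lemma T_pow_image_level:
  assumes "f \<in> heights n" "f + int k \<in> heights n"
  shows "(T ^^ k) ` level n f = level n (f + int k)"
  using assms(2)
proof (induction k)
  case (Suc k)
  then have *: "f + int k \<in> heights n" using assms(1) by (auto simp: heights_def)
  have "(T ^^ Suc k) ` level n f = T ` ((T ^^ k) ` level n f)" by (simp add: image_comp)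
  also have "\<dots> = T ` level n (f + int k)" using Suc.IH[OF *] by simp
  also have "\<dots> = level n (f + int k + 1)" using * Suc.prems by (intro T_image_level) (auto simp: algebra_simps)
  finally show ?case by (simp add: algebra_simps)
qed simp

lemma bij_T_pow: "bij (T ^^ k)"
  by (rule bij_fn[OF bij_T])

lemma T_pow_vimage_level:
  assumes "f \<in> heights n" "f + int k \<in> heights n"
  shows "(T ^^ k) -` level n (f + int k) = level n f"
  using T_pow_image_level[OF assms] inj_vimage_image_eq[of "T ^^ k" "level n f"] bij_T_pow[of k]
  by (simp add: bij_def)

section \<open>Measurability and preservation of Lebesgue measure\<close>

lemma level_borel [measurable, simp]: "f \<in> heights n \<Longrightarrow> level n f \<in> sets borel"
  by (simp add: level_eq)

lemma emeasure_level: "f \<in> heights n \<Longrightarrow> emeasure lborel (level n f) = ennreal (width n)"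
  using width_pos[of n] by (simp add: level_eq algebra_simps)

lemma measure_level: "f \<in> heights n \<Longrightarrow> measure lborel (level n f) = width n"
  using width_pos[of n] by (simp add: measure_def emeasure_level)

lemma level_fmeasurable: "f \<in> heights n \<Longrightarrow> level n f \<in> fmeasurable lborel"
  by (intro fmeasurableI) (auto simp: emeasure_level)

lemma emeasure_translate:
  fixes B :: "real set"
  assumes "B \<in> sets borel"
  shows "emeasure lborel ((\<lambda>x. x + t) -` B) = emeasure lborel B"
proof -
  have "emeasure (distr lborel borel ((+) t)) B = emeasure lborel ((+) t -` B \<inter> space lborel)"
    using assms by (intro emeasure_distr) auto
  then show ?thesis by (simp add: lborel_distr_plus vimage_def add.commute)
qed

lemma T_vimage_Int_level:
  assumes "f \<in> heights n" "f + 1 \<in> heights n"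
  shows "T -` A \<inter> level n f = (\<lambda>x. x + shift n f) -` (A \<inter> level n (f + 1))"
  using T_on_level[OF assms] shift_level_iff[OF assms] by auto

lemma T_image_Int_level:
  assumes "f \<in> heights n" "f + 1 \<in> heights n"
  shows "T ` (A \<inter> level n f) = (\<lambda>x. x + (- shift n f)) -` (A \<inter> level n f)"
proof (intro set_eqI iffI)
  fix y assume "y \<in> (\<lambda>x. x + (- shift n f)) -` (A \<inter> level n f)"
  then show "y \<in> T ` (A \<inter> level n f)"
    using T_on_level[OF assms, of "y - shift n f"] by (intro image_eqI[of _ _ "y - shift n f"]) auto
qed (use T_on_level[OF assms] in auto)

lemma vimage_translate_borel:
  fixes B :: "real set"
  assumes "B \<in> sets borel"
  shows "(\<lambda>x. x + t) -` B \<in> sets borel"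
  using assms by (intro measurable_sets_borel[of "\<lambda>x. x + t"]) auto

definition up_heights :: "nat \<Rightarrow> int set" where
  "up_heights n = {f \<in> heights n. f + 1 \<in> heights n}"

lemma up_eq: "{x. up n x} = (\<Union>f\<in>up_heights n. level n f)"
  using height_in_heights by (auto simp: up_def up_heights_def level_def)

lemma finite_up_heights: "finite (up_heights n)"
  by (simp add: up_heights_def)

lemma incseq_up: "incseq (\<lambda>n. {x. up n x})"
  by (rule incseq_SucI) (auto simp: up_Suc)

lemma UN_up: "(\<Union>n. {x. up n x}) = UNIV"
proof -
  have "\<exists>n. up n x" for x
    using eventually_inside[of x] by (auto simp: eventually_sequentially inside_def up_def)
  then show ?thesis by auto
qed

lemma T_vimage_borel:
  assumes "A \<in> sets borel"
  shows "T -` A \<in> sets borel"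
proof -
  have "T -` A = (\<Union>n. \<Union>f\<in>up_heights n. T -` A \<inter> level n f)"
    using UN_up by (auto simp: up_eq set_eq_iff)
  also have "\<dots> = (\<Union>n. \<Union>f\<in>up_heights n. (\<lambda>x. x + shift n f) -` (A \<inter> level n (f + 1)))"
    using T_vimage_Int_level by (simp add: up_heights_def)
  also have "\<dots> \<in> sets borel"
    using assms finite_up_heights
    by (intro sets.countable_UN'' sets.finite_UN vimage_translate_borel)
      (auto simp: up_heights_def)
  finally show ?thesis .
qed

lemma T_image_borel:
  assumes "A \<in> sets borel"
  shows "T ` A \<in> sets borel"
proof -
  have "T ` A = (\<Union>n. \<Union>f\<in>up_heights n. T ` (A \<inter> level n f))"
    using UN_up by (auto simp: up_eq set_eq_iff) blast
  also have "\<dots> = (\<Union>n. \<Union>f\<in>up_heights n. (\<lambda>x. x + (- shift n f)) -` (A \<inter> level n f))"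
    using T_image_Int_level by (simp add: up_heights_def)
  also have "\<dots> \<in> sets borel"
    using assms finite_up_heights
    by (intro sets.countable_UN'' sets.finite_UN vimage_translate_borel)
      (auto simp: up_heights_def)
  finally show ?thesis .
qed

lemma T_measurable [measurable]: "T \<in> borel_measurable borel"
  by (rule measurableI) (auto simp: T_vimage_borel)

text \<open>On each of the finitely many levels below the top, \<open>T\<close> is a translation, so
  finite additivity suffices here. The passage to the whole line is a monotone limit.\<close>

lemma emeasure_T_vimage_up:
  assumes "A \<in> sets borel"
  shows "emeasure lborel (T -` A \<inter> {x. up n x}) = emeasure lborel (A \<inter> T ` {x. up n x})"
proof -
  have "emeasure lborel (T -` A \<inter> {x. up n x}) = emeasure lborel (\<Union>f\<in>up_heights n. T -` A \<inter> level n f)"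
    by (simp add: up_eq)
  also have "\<dots> = (\<Sum>f\<in>up_heights n. emeasure lborel (T -` A \<inter> level n f))"
    using assms level_disjoint finite_up_heights
    by (intro sum_emeasure[symmetric]) (auto simp: disjoint_family_on_def up_heights_def T_vimage_borel)
  also have "\<dots> = (\<Sum>f\<in>up_heights n. emeasure lborel (A \<inter> level n (f + 1)))"
    using assms by (intro sum.cong refl)
      (simp add: up_heights_def T_vimage_Int_level emeasure_translate del: vimage_Int)
  also have "\<dots> = emeasure lborel (\<Union>f\<in>up_heights n. A \<inter> level n (f + 1))"
  proof (rule sum_emeasure)
    show "disjoint_family_on (\<lambda>f. A \<inter> level n (f + 1)) (up_heights n)"
      by (auto simp: disjoint_family_on_def level_def)
  qed (use assms finite_up_heights in \<open>auto simp: up_heights_def\<close>)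
  also have "(\<Union>f\<in>up_heights n. A \<inter> level n (f + 1)) = A \<inter> T ` {x. up n x}"
    by (simp add: up_eq image_UN T_image_level up_heights_def)
  finally show ?thesis .
qed

lemma emeasure_T_vimage:
  assumes "A \<in> sets borel"
  shows "emeasure lborel (T -` A) = emeasure lborel A"
proof -
  have upb: "{x. up n x} \<in> sets borel" for n
    unfolding up_eq using finite_up_heights by (intro sets.finite_UN) (auto simp: up_heights_def)
  have "emeasure lborel (T -` A) = emeasure lborel (\<Union>n. T -` A \<inter> {x. up n x})"
    using UN_up by (simp flip: Int_UN_distrib)
  also have "\<dots> = (SUP n. emeasure lborel (T -` A \<inter> {x. up n x}))"
    using assms upb incseq_up
    by (intro SUP_emeasure_incseq[symmetric]) (auto simp: T_vimage_borel incseq_def)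
  also have "\<dots> = (SUP n. emeasure lborel (A \<inter> T ` {x. up n x}))"
    by (simp add: emeasure_T_vimage_up[OF assms])
  also have "\<dots> = emeasure lborel (\<Union>n. A \<inter> T ` {x. up n x})"
  proof (rule SUP_emeasure_incseq)
    show "incseq (\<lambda>n. A \<inter> T ` {x. up n x})"
      using incseq_up by (fastforce simp: incseq_def)
  qed (use assms upb in \<open>auto simp: T_image_borel\<close>)
  also have "(\<Union>n. A \<inter> T ` {x. up n x}) = A"
    using UN_up surj_T by (simp flip: Int_UN_distrib image_UN)
  finally show ?thesis .
qed

lemma T_pow_measurable [measurable]: "T ^^ k \<in> borel_measurable borel"
  by (induction k) (auto simp: id_def)

lemma T_pow_vimage_borel: "A \<in> sets borel \<Longrightarrow> (T ^^ k) -` A \<in> sets borel"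
  using measurable_sets_borel[OF T_pow_measurable] .

lemma emeasure_T_pow_vimage:
  "A \<in> sets borel \<Longrightarrow> emeasure lborel ((T ^^ k) -` A) = emeasure lborel A"
proof (induction k)
  case (Suc k)
  have "(T ^^ Suc k) -` A = T -` ((T ^^ k) -` A)" by (auto simp: funpow_swap1)
  then show ?case using Suc by (simp only: emeasure_T_vimage T_pow_vimage_borel)
qed simp

lemma T_pow_image_borel: "A \<in> sets borel \<Longrightarrow> (T ^^ k) ` A \<in> sets borel"
  by (induction k) (simp_all only: funpow.simps image_comp[symmetric] T_image_borel image_id id_apply)

lemma emeasure_T_pow_image:
  "A \<in> sets borel \<Longrightarrow> emeasure lborel ((T ^^ k) ` A) = emeasure lborel A"
  using emeasure_T_pow_vimage[OF T_pow_image_borel, of A k k] bij_T_pow[of k]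
  by (simp add: bij_def inj_vimage_image_eq)

lemma invertible_measure_preserving_T: "invertible_measure_preserving lborel T"
proof -
  have "inv T \<in> borel_measurable borel"
    using bij_vimage_eq_inv_image[OF bij_imp_bij_inv[OF bij_T]]
    by (intro measurableI) (auto simp: T_image_borel inv_inv_eq[OF bij_T])
  then show ?thesis
    using bij_T T_measurable emeasure_T_vimage
    by (auto simp: invertible_measure_preserving_def measure_preserving_def measurable_lborel1 measurable_lborel2)
qed

lemma width_le: "width n \<le> (1 / 2) ^ n"
proof (induction n)
  case (Suc n)
  have "width n / real_of_int (cuts n) \<le> width n / 2"
    using cuts_eq[of n] plain_ge[of n] half_height_ge_1[of n] width_pos[of n] by (intro divide_left_mono) auto
  then show ?case using Suc by simp
qed simp

lemma width_tendsto_0: "width \<longlonglongrightarrow> 0"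
proof (rule tendsto_sandwich[OF _ _ tendsto_const])
  show "(\<lambda>n. (1 / 2 :: real) ^ n) \<longlonglongrightarrow> 0" by (rule LIMSEQ_realpow_zero) auto
qed (use width_le width_pos less_imp_le in \<open>auto intro!: always_eventually\<close>)

section \<open>Approximation by unions of levels\<close>

text \<open>Take an open superset \<open>U\<close> of \<open>A\<close> with small excess. The levels
  contained in \<open>U\<close> have unions increasing to \<open>U\<close>, which has finite
  measure, so they fill \<open>U\<close> up to \<open>e\<close> from some stage on.\<close>

lemma eventually_approx:
  assumes "A \<in> sets borel" "emeasure lborel A < \<infinity>" "0 < e"
  shows "\<forall>\<^sub>F n in sequentially. \<exists>S\<subseteq>heights n.
    measure lborel (A - (\<Union>f\<in>S. level n f)) < e \<and> measure lborel ((\<Union>f\<in>S. level n f) - A) < e"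
proof -
  obtain U where U: "open U" "A \<subseteq> U" "emeasure lborel (U - A) < ennreal e"
    using outer_regular_lborel[of A e] assms by auto
  define S where "S n = {f \<in> heights n. level n f \<subseteq> U}" for n
  define V where "V n = (\<Union>f\<in>S n. level n f)" for n
  have Sfin: "finite (S n)" for n unfolding S_def by simp
  have Vb: "V n \<in> sets borel" for n
    unfolding V_def using Sfin by (intro sets.finite_UN) (auto simp: S_def)
  have VU: "V n \<subseteq> U" for n by (auto simp: V_def S_def)
  have "emeasure lborel U \<le> emeasure lborel (U - A) + emeasure lborel A"
    using U assms by (intro order_trans[OF emeasure_mono emeasure_subadditive]) auto
  also have "\<dots> < \<infinity>"
    using order_less_trans[OF U(3) ennreal_less_top] assms(2)
    by (simp add: less_top[symmetric] ennreal_add_eq_top)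
  finally have Ufin: "emeasure lborel U < \<infinity>" .
  \<comment> \<open>A level inside \<open>U\<close> splits into levels of the next column that are
    again inside \<open>U\<close>.\<close>
  have "incseq V"
  proof (rule incseq_SucI, rule subsetI)
    fix n x assume "x \<in> V n"
    then obtain f where f: "f \<in> heights n" "level n f \<subseteq> U" "x \<in> level n f" by (auto simp: V_def S_def)
    then obtain k where k: "k \<in> {0..<cuts n}" "x \<in> level (Suc n) (f + offset n k)"
      using level_split[OF f(1)] by auto
    then have "level (Suc n) (f + offset n k) \<subseteq> U" using f level_split[OF f(1)] by blast
    then show "x \<in> V (Suc n)" using k offset_heights(1)[OF f(1) k(1)] by (auto simp: V_def S_def)
  qed
  moreover have UV: "(\<Union>n. V n) = U"
  proof (intro equalityI subsetI)
    fix x assume "x \<in> U"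
    then obtain d where d: "0 < d" "ball x d \<subseteq> U" using U(1) openE by blast
    have "\<forall>\<^sub>F n in sequentially. width n < d" using width_tendsto_0 d(1) by (rule order_tendstoD)
    with eventually_inside[of x] have "\<forall>\<^sub>F n in sequentially. inside n x \<and> width n < d"
      by eventually_elim simp
    then obtain n where n: "inside n x" "width n < d" by (auto simp: eventually_sequentially)
    define f where "f = height n x"
    have f: "f \<in> heights n" "x \<in> level n f"
      using n height_in_heights[of n x] by (auto simp: f_def inside_def level_def)
    have "level n f \<subseteq> ball x d"
      using f n(2) by (auto simp: level_eq dist_real_def algebra_simps)
    then show "x \<in> (\<Union>n. V n)" using d f by (auto simp: V_def S_def)
  qed (use VU in auto)
  ultimately have "(\<lambda>n. measure lborel (V n)) \<longlonglongrightarrow> measure lborel U"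
    using Lim_measure_incseq[of V lborel] Vb Ufin by (simp add: image_subset_iff)
  moreover have "measure lborel U - e < measure lborel U" using assms(3) by simp
  ultimately have "\<forall>\<^sub>F n in sequentially. measure lborel U - e < measure lborel (V n)"
    by (rule order_tendstoD)
  then show ?thesis
  proof eventually_elim
    case (elim n)
    have Uf: "U \<in> fmeasurable lborel" using Ufin U(1) by (intro fmeasurableI) auto
    have Vf: "V n \<in> fmeasurable lborel" by (rule fmeasurableI2[OF Uf VU]) (simp add: Vb)
    have "measure lborel (A - V n) \<le> measure lborel (U - V n)"
      using U(2) Uf Vf Vb[of n] assms(1) by (intro measure_mono_fmeasurable) auto
    also have "\<dots> = measure lborel U - measure lborel (V n)"
      using Uf Vf VU[of n] by (intro measurable_measure_Diff) auto
    finally have 1: "measure lborel (A - V n) < e" using elim by simp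
    have "measure lborel (V n - A) \<le> measure lborel (U - A)"
      using VU[of n] Uf Vb[of n] assms(1) by (intro measure_mono_fmeasurable) (auto intro: fmeasurable_Diff)
    moreover have "emeasure lborel (U - A) = ennreal (measure lborel (U - A))"
      using order_less_trans[OF U(3) ennreal_less_top] by (intro emeasure_eq_ennreal_measure) simp
    then have "measure lborel (U - A) < e" using U(3) by (simp add: ennreal_less_iff)
    ultimately have "measure lborel (V n - A) < e" by simp
    then show ?case using 1 by (intro exI[of _ "S n"]) (auto simp: V_def S_def)
  qed
qed

section \<open>Rigidity\<close>

lemma measure_UN_levels:
  assumes "S \<subseteq> heights n"
  shows "measure lborel (\<Union>f\<in>S. level n f) = real (card S) * width n"
proof -
  have "measure lborel (\<Union>f\<in>S. level n f) = (\<Sum>f\<in>S. measure lborel (level n f))"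
    using assms finite_subset[OF assms finite_heights] level_disjoint
    by (intro measure_UNION') (auto simp: pairwise_def disjnt_def level_fmeasurable)
  also have "\<dots> = (\<Sum>f\<in>S. width n)" using assms by (intro sum.cong) (auto simp: measure_level)
  finally show ?thesis by simp
qed

lemma UN_levels_borel: "S \<subseteq> heights n \<Longrightarrow> (\<Union>f\<in>S. level n f) \<in> sets borel"
  using finite_subset[OF _ finite_heights] by (intro sets.finite_UN) auto

lemma UN_levels_fmeasurable: "S \<subseteq> heights n \<Longrightarrow> (\<Union>f\<in>S. level n f) \<in> fmeasurable lborel"
  using finite_subset[OF _ finite_heights] by (intro fmeasurable.finite_UN) (auto intro!: level_fmeasurable)

lemma gap_pos: "0 < gap n"
  using gap_ge[of n] half_height_ge_1[of n] by linarith

text \<open>\<open>T ^^ nat (gap n)\<close> carries plain piece \<open>k - 1\<close> of a level onto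
  plain piece \<open>k\<close> of the same level. Only piece 0 and the
  \<open>8 * half_height n\<close> special pieces can be missed, at most
  \<open>12 * half_height n\<close> out of \<open>(n + 6) * (4 * half_height n)\<close>.\<close>

lemma measure_level_gap:
  assumes f: "f \<in> heights n"
  shows "measure lborel (level n f - (T ^^ nat (gap n)) ` level n f) \<le> 3 / (real n + 6) * width n"
proof -
  let ?D = "insert 0 {plain n..<cuts n}"
  have sub: "level n f - (T ^^ nat (gap n)) ` level n f \<subseteq> (\<Union>k\<in>?D. level (Suc n) (f + offset n k))"
  proof
    fix x assume x: "x \<in> level n f - (T ^^ nat (gap n)) ` level n f"
    then obtain k where k: "k \<in> {0..<cuts n}" "x \<in> level (Suc n) (f + offset n k)"
      using level_split[OF f] by auto
    have "\<not> (1 \<le> k \<and> k < plain n)"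
    proof
      assume kp: "1 \<le> k \<and> k < plain n"
      have k1: "k - 1 \<in> {0..<cuts n}" using kp k(1) by auto
      have e: "f + offset n (k - 1) + int (nat (gap n)) = f + offset n k"
        using kp gap_pos[of n] by (simp add: offset_def algebra_simps)
      have "(T ^^ nat (gap n)) ` level (Suc n) (f + offset n (k - 1)) = level (Suc n) (f + offset n k)"
        using T_pow_image_level[OF offset_heights(1)[OF f k1], of "nat (gap n)", unfolded e]
          offset_heights(1)[OF f k(1)] by simp
      moreover have "level (Suc n) (f + offset n (k - 1)) \<subseteq> level n f"
        using level_split[OF f] k1 by auto
      ultimately have "x \<in> (T ^^ nat (gap n)) ` level n f" using k(2) by blast
      then show False using x by simp
    qed
    then have "k \<in> ?D" using k(1) by auto
    then show "x \<in> (\<Union>k\<in>?D. level (Suc n) (f + offset n k))" using k(2) by blast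
  qed
  have D: "?D \<subseteq> {0..<cuts n}" using cuts_pos[of n] plain_ge[of n] half_height_ge_1[of n] by auto
  have lb: "level (Suc n) (f + offset n k) \<in> fmeasurable lborel" if "k \<in> ?D" for k
    using D that f by (intro level_fmeasurable offset_heights(1)) auto
  have "measure lborel (level n f - (T ^^ nat (gap n)) ` level n f)
      \<le> measure lborel (\<Union>k\<in>?D. level (Suc n) (f + offset n k))"
    using sub f lb by (intro measure_mono_fmeasurable fmeasurable.finite_UN) (auto simp: T_pow_image_borel)
  also have "\<dots> \<le> (\<Sum>k\<in>?D. measure lborel (level (Suc n) (f + offset n k)))"
    using fmeasurableD[OF lb] by (intro measure_UNION_le) simp_all
  also have "\<dots> = (\<Sum>k\<in>?D. width (Suc n))"
    using D f by (intro sum.cong refl measure_level offset_heights(1)) auto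
  also have "\<dots> = (1 + 8 * real_of_int (half_height n)) * width (Suc n)"
    using plain_ge[of n] half_height_ge_1[of n] by (simp add: cuts_eq algebra_simps del: width.simps)
  also have "\<dots> \<le> (12 * real_of_int (half_height n)) * width (Suc n)"
    using half_height_ge_1[of n] width_pos[of "Suc n"] by (intro mult_right_mono) auto
  also have "\<dots> = 3 / (real n + 6) * width n"
    unfolding width_Suc[of n] by (simp add: cuts_def field_simps del: width.simps)
  finally show ?thesis .
qed

lemma measure_UN_levels_gap:
  assumes S: "S \<subseteq> heights n"
  defines "U \<equiv> \<Union>f\<in>S. level n f"
  shows "measure lborel (U - (T ^^ nat (gap n)) ` U) \<le> 3 / (real n + 6) * measure lborel U"
proof -
  have fin: "finite S" using finite_subset[OF S finite_heights] .
  let ?L = "\<lambda>f. level n f - (T ^^ nat (gap n)) ` level n f"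
  have Lf: "?L f \<in> fmeasurable lborel" if "f \<in> S" for f
    using that S by (intro fmeasurable_Diff level_fmeasurable) (auto simp: T_pow_image_borel)
  have "measure lborel (U - (T ^^ nat (gap n)) ` U) \<le> measure lborel (\<Union>f\<in>S. ?L f)"
    using UN_levels_borel[OF S] Lf fin
    by (intro measure_mono_fmeasurable fmeasurable.finite_UN) (auto simp: U_def T_pow_image_borel)
  also have "\<dots> \<le> (\<Sum>f\<in>S. measure lborel (?L f))"
    using fmeasurableD[OF Lf] fin by (intro measure_UNION_le) simp_all
  also have "\<dots> \<le> (\<Sum>f\<in>S. 3 / (real n + 6) * width n)"
    using S by (intro sum_mono measure_level_gap) auto
  also have "\<dots> = 3 / (real n + 6) * measure lborel U"
    unfolding U_def measure_UN_levels[OF S] by simp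
  finally show ?thesis .
qed

lemma measure_T_pow_image: "A \<in> sets borel \<Longrightarrow> measure lborel ((T ^^ k) ` A) = measure lborel A"
  by (simp add: measure_def emeasure_T_pow_image)

lemma measure_gap_tendsto:
  assumes A: "A \<in> sets borel" "emeasure lborel A < \<infinity>"
  shows "(\<lambda>n. measure lborel (A - (T ^^ nat (gap n)) ` A)) \<longlonglongrightarrow> 0"
proof (rule order_tendstoI)
  fix e :: real assume "0 < e"
  define d where "d = e / 3"
  have d: "0 < d" using \<open>0 < e\<close> by (simp add: d_def)
  have Af: "A \<in> fmeasurable lborel" using A by (intro fmeasurableI) auto
  have "(\<lambda>n. 3 / (6 + real n)) \<longlonglongrightarrow> 0"
    by (intro tendsto_divide_0[OF tendsto_const] filterlim_at_top_imp_at_infinity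
        filterlim_tendsto_add_at_top[OF tendsto_const] filterlim_real_sequentially)
  from tendsto_mult_left_zero[OF this, of "measure lborel A + d"]
  have "(\<lambda>n. 3 / (real n + 6) * (measure lborel A + d)) \<longlonglongrightarrow> 0"
    by (simp add: add.commute)
  then have "\<forall>\<^sub>F n in sequentially. 3 / (real n + 6) * (measure lborel A + d) < d"
    using d by (rule order_tendstoD)
  with eventually_approx[OF A d]
  show "\<forall>\<^sub>F n in sequentially. measure lborel (A - (T ^^ nat (gap n)) ` A) < e"
  proof eventually_elim
    case (elim n)
    then obtain S where S: "S \<subseteq> heights n" "measure lborel (A - (\<Union>f\<in>S. level n f)) < d"
      "measure lborel ((\<Union>f\<in>S. level n f) - A) < d" by blast
    define U where "U = (\<Union>f\<in>S. level n f)"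
    let ?R = "T ^^ nat (gap n)"
    have Uf: "U \<in> fmeasurable lborel" unfolding U_def by (rule UN_levels_fmeasurable[OF S(1)])
    have Rf: "?R ` B \<in> fmeasurable lborel" if "B \<in> fmeasurable lborel" for B
      using that by (auto simp: fmeasurable_def T_pow_image_borel emeasure_T_pow_image)
    have fm: "A - U \<in> fmeasurable lborel" "U - ?R ` U \<in> fmeasurable lborel" "?R ` (U - A) \<in> fmeasurable lborel"
      "U - A \<in> fmeasurable lborel"
      using Uf Af Rf by (auto intro!: fmeasurable_Diff fmeasurableD)
    have "measure lborel U \<le> measure lborel (A \<union> (U - A))"
      using Uf Af fm by (intro measure_mono_fmeasurable fmeasurable.Un) auto
    also have "\<dots> \<le> measure lborel A + measure lborel (U - A)"
      using Af fm by (intro measure_Un_le) auto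
    finally have mU: "measure lborel U \<le> measure lborel A + d" using S(3) by (simp add: U_def)
    \<comment> \<open>A point of \<open>A\<close> outside the image of \<open>A\<close> is outside
      \<open>U\<close>, or in \<open>U\<close> but outside the image of \<open>U\<close>, or in the
      image of \<open>U - A\<close>. Each of these three sets has measure below
      \<open>d\<close>.\<close>
    have "measure lborel (A - ?R ` A) \<le> measure lborel ((A - U) \<union> (U - ?R ` U) \<union> ?R ` (U - A))"
      using fm A(1) by (intro measure_mono_fmeasurable fmeasurable.Un) (auto simp: T_pow_image_borel)
    also have "\<dots> \<le> measure lborel ((A - U) \<union> (U - ?R ` U)) + measure lborel (?R ` (U - A))"
      using fm by (intro measure_Un_le fmeasurableD fmeasurable.Un) auto
    also have "\<dots> \<le> measure lborel (A - U) + measure lborel (U - ?R ` U) + measure lborel (?R ` (U - A))"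
      using fm by (intro add_right_mono measure_Un_le fmeasurableD) auto
    also have "measure lborel (?R ` (U - A)) = measure lborel (U - A)"
      using fm by (intro measure_T_pow_image) auto
    also have "measure lborel (U - ?R ` U) \<le> 3 / (real n + 6) * measure lborel U"
      unfolding U_def by (rule measure_UN_levels_gap[OF S(1)])
    also have "3 / (real n + 6) * measure lborel U \<le> 3 / (real n + 6) * (measure lborel A + d)"
      using mU by (intro mult_left_mono) auto
    finally have "measure lborel (A - ?R ` A) < d + d + d"
      using S(2,3) elim(2) unfolding U_def by linarith
    then show ?case by (simp add: d_def)
  qed
qed (auto intro!: always_eventually less_le_trans[OF _ measure_nonneg])

lemma half_height_ge: "int n \<le> half_height n"
proof (cases n)
  case (Suc m)
  have "1 \<le> half_height m ^ 3" using half_height_ge_1[of m] by (simp add: one_le_power)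
  then have "(int m + 6) * 1 \<le> (2560 * (int m + 6)) * half_height m ^ 3" by (intro mult_mono) auto
  then show ?thesis using Suc by simp
qed simp

lemma rigid_T: "rigid lborel T"
  unfolding rigid_def partially_rigid_def
proof (intro ballI impI exI conjI)
  fix A :: "real set" assume A: "A \<in> sets lborel" "emeasure lborel A < \<infinity>"
  have "n \<le> nat (gap n)" for n using half_height_ge[of n] gap_ge[of n] by linarith
  then show "filterlim (\<lambda>n. nat (gap n)) at_top sequentially"
    by (intro filterlim_at_top_mono[OF filterlim_ident]) auto
  have Af: "A \<in> fmeasurable lborel" using A by (intro fmeasurableI) auto
  have "measure lborel (A \<inter> (T ^^ k) ` A) = measure lborel A - measure lborel (A - (T ^^ k) ` A)" for k
  proof -
    have "measure lborel (A - (A - (T ^^ k) ` A)) = measure lborel A - measure lborel (A - (T ^^ k) ` A)"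
      using Af A by (intro measurable_measure_Diff fmeasurable_Diff) (auto simp: T_pow_image_borel)
    then show ?thesis by (simp add: Diff_Diff_Int)
  qed
  moreover have "(\<lambda>n. measure lborel A - measure lborel (A - (T ^^ nat (gap n)) ` A)) \<longlonglongrightarrow>
      measure lborel A - 0"
    using A by (intro tendsto_diff tendsto_const measure_gap_tendsto) auto
  ultimately show "(\<lambda>n. measure lborel (A \<inter> (T ^^ nat (gap n)) ` A)) \<longlonglongrightarrow> measure lborel A"
    by simp
qed auto

section \<open>Weak double ergodicity\<close>

text \<open>An averaging argument: if every level of a good approximating union missed the
  proportion \<open>d\<close> of its width, the union would stick out of the set too much.\<close>

lemma eventually_dense_level:
  assumes A: "A \<in> sets borel" "0 < emeasure lborel A" and "0 < d"
  shows "\<forall>\<^sub>F n in sequentially. \<exists>f\<in>heights n. measure lborel (level n f - A) < d * width n"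
proof -
  \<comment> \<open>Cutting \<open>A\<close> down to a bounded window makes its measure finite, as
    the approximation requires.\<close>
  obtain R :: nat where R: "0 < emeasure lborel (A \<inter> {- real R..real R})"
  proof (rule ccontr)
    assume "\<not> thesis"
    then have "emeasure lborel (A \<inter> {- real R..real R}) = 0" for R :: nat
      using that[of R] by (auto simp: zero_less_iff_neq_zero)
    then have "A \<inter> {- real R..real R} \<in> null_sets lborel" for R :: nat
      using A by (auto intro!: null_setsI)
    then have "(\<Union>R::nat. A \<inter> {- real R..real R}) \<in> null_sets lborel"
      by (intro null_sets_UN) auto
    moreover have "(\<Union>R::nat. A \<inter> {- real R..real R}) = A"
    proof -
      have "\<exists>R::nat. x \<in> {- real R..real R}" for x :: real
        using real_arch_simple[of "\<bar>x\<bar>"] by (auto simp: abs_le_iff minus_le_iff)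
      then show ?thesis by blast
    qed
    ultimately show False using A(2) by auto
  qed
  define B where "B = A \<inter> {- real R..real R}"
  have B: "B \<in> sets borel" using A by (simp add: B_def)
  have "emeasure lborel B \<le> emeasure lborel {- real R..real R}"
    unfolding B_def by (intro emeasure_mono) auto
  then have Bfin: "emeasure lborel B < \<infinity>" by (auto simp: top_unique less_top[symmetric] intro: le_less_trans)
  then have Bf: "B \<in> fmeasurable lborel" using B by (intro fmeasurableI) auto
  define b where "b = measure lborel B"
  have b: "0 < b" using R Bfin unfolding b_def B_def[symmetric]
    by (simp add: measure_def enn2real_positive_iff)
  \<comment> \<open>This is the solution of \<open>d * (b - e) = e\<close>, where
    \<open>b - e\<close> bounds the measure of the union from below.\<close>
  define e where "e = d * b / (1 + d)"
  have e: "0 < e" "d * (b - e) = e" using b \<open>0 < d\<close> by (auto simp: e_def field_simps)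
  show ?thesis using eventually_approx[OF B Bfin e(1)]
  proof eventually_elim
    case (elim n)
    then obtain S where S: "S \<subseteq> heights n" "measure lborel (B - (\<Union>f\<in>S. level n f)) < e"
      "measure lborel ((\<Union>f\<in>S. level n f) - B) < e" by blast
    define U where "U = (\<Union>f\<in>S. level n f)"
    have fin: "finite S" using finite_subset[OF S(1) finite_heights] .
    have Uf: "U \<in> fmeasurable lborel" unfolding U_def by (rule UN_levels_fmeasurable[OF S(1)])
    have lf: "level n f - B \<in> fmeasurable lborel" if "f \<in> S" for f
      using that S(1) B by (intro fmeasurable_Diff level_fmeasurable) auto
    have "b \<le> measure lborel (U \<union> (B - U))"
      unfolding b_def using Uf Bf by (intro measure_mono_fmeasurable fmeasurable.Un fmeasurable_Diff) auto
    also have "\<dots> \<le> measure lborel U + measure lborel (B - U)"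
      using Uf Bf by (intro measure_Un_le fmeasurableD fmeasurable_Diff) auto
    finally have "b - e < measure lborel U" using S(2) by (simp add: U_def)
    then have "d * (b - e) < d * measure lborel U" using \<open>0 < d\<close> by simp
    then have "e < d * measure lborel U" using e by simp
    moreover have "measure lborel (U - B) = (\<Sum>f\<in>S. measure lborel (level n f - B))"
    proof -
      have "U - B = (\<Union>f\<in>S. level n f - B)" by (auto simp: U_def)
      then show ?thesis using lf fin level_disjoint
        by (simp only:) (intro measure_UNION', auto simp: pairwise_def disjnt_def level_def)
    qed
    ultimately have "(\<Sum>f\<in>S. measure lborel (level n f - B)) < (\<Sum>f\<in>S. d * width n)"
      using S(3) measure_UN_levels[OF S(1)] by (simp add: U_def mult.left_commute)
    then obtain f where f: "f \<in> S" "measure lborel (level n f - B) < d * width n"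
      by (meson not_le sum_mono)
    have "measure lborel (level n f - A) \<le> measure lborel (level n f - B)"
      using lf[OF f(1)] A(1) S(1) f(1) by (intro measure_mono_fmeasurable) (auto simp: B_def)
    then show ?case using f S(1) by (intro bexI[of _ f]) auto
  qed
qed


section \<open>Defects of levels and shifted blocks of pieces\<close>

definition defect :: "nat \<Rightarrow> real set \<Rightarrow> int \<Rightarrow> real" where
  "defect n A f = measure lborel (level n f - A)"

lemma defect_nonneg: "0 \<le> defect n A f"
  by (simp add: defect_def)

lemma defect_split:
  assumes f: "f \<in> heights n" and A: "A \<in> sets borel"
  shows "defect n A f = (\<Sum>k\<in>{0..<cuts n}. defect (Suc n) A (f + offset n k))"
proof -
  have "level n f - A = (\<Union>k\<in>{0..<cuts n}. level (Suc n) (f + offset n k) - A)"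
    using level_split[OF f] by blast
  moreover have "measure lborel (\<Union>k\<in>{0..<cuts n}. level (Suc n) (f + offset n k) - A) =
      (\<Sum>k\<in>{0..<cuts n}. measure lborel (level (Suc n) (f + offset n k) - A))"
  proof (rule measure_UNION')
    show "level (Suc n) (f + offset n k) - A \<in> fmeasurable lborel" if "k \<in> {0..<cuts n}" for k
      using that A f by (intro fmeasurable_Diff level_fmeasurable offset_heights(1)) auto
    show "pairwise (\<lambda>k l. disjnt (level (Suc n) (f + offset n k) - A) (level (Suc n) (f + offset n l) - A))
        {0..<cuts n}"
      using offset_inj[OF f f] by (fastforce simp: pairwise_def disjnt_def level_def)
  qed simp
  ultimately show ?thesis by (simp add: defect_def)
qed

text \<open>\<open>T ^^ d\<close> carries level \<open>f\<close> onto level \<open>f + d\<close>.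
  The parts of level \<open>f\<close> that are outside \<open>Y\<close> or are sent outside
  \<open>X\<close> are too small to cover it.\<close>

lemma levels_meet:
  assumes f: "f \<in> heights n" "f + int d \<in> heights n" and XY: "X \<in> sets borel" "Y \<in> sets borel"
    and small: "defect n X (f + int d) + defect n Y f < width n"
  shows "0 < emeasure lborel (Y \<inter> (T ^^ d) -` X)"
proof (rule ccontr)
  assume "\<not> ?thesis"
  then have null: "emeasure lborel (Y \<inter> (T ^^ d) -` X) = 0" by (simp add: zero_less_iff_neq_zero)
  have Nf: "Y \<inter> (T ^^ d) -` X \<in> fmeasurable lborel"
    using XY null by (intro fmeasurableI) (auto simp: T_pow_vimage_borel)
  have "level n f - (T ^^ d) -` X = (T ^^ d) -` (level n (f + int d) - X)"
    using T_pow_vimage_level[OF f] by auto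
  then have e: "measure lborel (level n f - (T ^^ d) -` X) = defect n X (f + int d)"
    using f XY by (simp add: defect_def measure_def emeasure_T_pow_vimage del: vimage_Diff)
  have Xf: "level n f - (T ^^ d) -` X \<in> fmeasurable lborel" and Yf: "level n f - Y \<in> fmeasurable lborel"
    using f XY by (auto intro!: fmeasurable_Diff level_fmeasurable simp: T_pow_vimage_borel)
  have "width n = measure lborel (level n f)" using f by (simp add: measure_level)
  also have "\<dots> \<le> measure lborel ((level n f - (T ^^ d) -` X) \<union> (level n f - Y) \<union> (Y \<inter> (T ^^ d) -` X))"
    using f Xf Yf Nf by (intro measure_mono_fmeasurable fmeasurable.Un) auto
  also have "\<dots> \<le> measure lborel ((level n f - (T ^^ d) -` X) \<union> (level n f - Y)) + measure lborel (Y \<inter> (T ^^ d) -` X)"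
    using Xf Yf Nf by (intro measure_Un_le fmeasurableD fmeasurable.Un) auto
  also have "\<dots> \<le> measure lborel (level n f - (T ^^ d) -` X) + measure lborel (level n f - Y) + 0"
    using Xf Yf null by (intro add_mono measure_Un_le) (auto simp: measure_def)
  finally show False using small e by (simp add: defect_def)
qed

text \<open>If every shifted pair reached \<open>w\<close>, summing over the \<open>L - s\<close>
  pairs would exceed the total of both families.\<close>

lemma ex_small_shifted_pair:
  fixes a b :: "int \<Rightarrow> real"
  assumes nonneg: "\<And>t. 0 \<le> a t" "\<And>t. 0 \<le> b t" and s: "0 \<le> s" and w: "0 \<le> w"
    and sum: "(\<Sum>t\<in>{0..<L}. a t) + (\<Sum>t\<in>{0..<L}. b t) < real_of_int (L - s) * w"
  shows "\<exists>t\<in>{0..<L - s}. a (t + s) + b t < w"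
proof (rule ccontr)
  assume "\<not> ?thesis"
  then have "(\<Sum>t\<in>{0..<L - s}. w) \<le> (\<Sum>t\<in>{0..<L - s}. a (t + s) + b t)"
    by (intro sum_mono) (auto simp: not_less)
  also have "\<dots> = (\<Sum>t\<in>{s..<L}. a t) + (\<Sum>t\<in>{0..<L - s}. b t)"
  proof -
    have "(\<Sum>t\<in>{0..<L - s}. a (t + s)) = (\<Sum>t\<in>{s..<L}. a t)"
      by (rule sum.reindex_bij_witness[of _ "\<lambda>t. t - s" "\<lambda>t. t + s"]) auto
    then show ?thesis by (simp add: sum.distrib)
  qed
  also have "\<dots> \<le> (\<Sum>t\<in>{0..<L}. a t) + (\<Sum>t\<in>{0..<L}. b t)"
    using s nonneg by (intro add_mono sum_mono2) auto
  finally have "real (nat (L - s)) * w < real_of_int (L - s) * w" using sum by simp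
  moreover have "real_of_int (L - s) * w \<le> real (nat (L - s)) * w"
    using w by (intro mult_right_mono) auto
  ultimately show False by simp
qed

text \<open>In a block with spacing \<open>h\<close>, \<open>T ^^ d\<close> carries piece
  \<open>t\<close> of level \<open>f'\<close> onto piece \<open>t + s\<close> of level
  \<open>f\<close>. Averaging over the block finds a \<open>t\<close> for which both pieces have
  small defect.\<close>

lemma block_meets:
  assumes f: "f \<in> heights n" "f' \<in> heights n" and XY: "X \<in> sets borel" "Y \<in> sets borel"
    and block: "\<And>t. t \<in> {0..<L} \<Longrightarrow> k0 + t \<in> {0..<cuts n}"
    and spacing: "\<And>t. t \<in> {0..<L - s} \<Longrightarrow> offset n (k0 + (t + s)) = offset n (k0 + t) + s * h"
    and s: "0 \<le> s" and d: "int d = f - f' + s * h"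
    and sum: "(\<Sum>t\<in>{0..<L}. defect (Suc n) X (f + offset n (k0 + t))) +
      (\<Sum>t\<in>{0..<L}. defect (Suc n) Y (f' + offset n (k0 + t))) < real_of_int (L - s) * width (Suc n)"
  shows "0 < emeasure lborel (Y \<inter> (T ^^ d) -` X)"
proof -
  obtain t where t: "t \<in> {0..<L - s}" "defect (Suc n) X (f + offset n (k0 + (t + s))) +
      defect (Suc n) Y (f' + offset n (k0 + t)) < width (Suc n)"
    using ex_small_shifted_pair[OF defect_nonneg defect_nonneg s less_imp_le[OF width_pos] sum] by blast
  have e: "f + offset n (k0 + (t + s)) = f' + offset n (k0 + t) + int d"
    using spacing[OF t(1)] d by simp
  have "f' + offset n (k0 + t) \<in> heights (Suc n)" "f + offset n (k0 + (t + s)) \<in> heights (Suc n)"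
    using t(1) s by (auto intro!: offset_heights(1) f block)
  then show ?thesis using t(2) unfolding e by (intro levels_meet[OF _ _ XY]) auto
qed

text \<open>The factor subtracted from 1 in the proof is the proportion of points which are plain at all
  stages from \<open>m\<close> to \<open>m + i - 1\<close>; it is the telescoping product of the \<open>(k + 4) / (k + 6)\<close>.\<close>

lemma ex_good_block:
  assumes AB: "A \<in> sets borel" "B \<in> sets borel" and ab: "a \<in> heights n" "b \<in> heights n"
    and small: "defect n A a + defect n B b < width n / 16"
  obtains m a' b' where "n \<le> m" "a' \<in> heights m" "b' \<in> heights m" "a' - b' = a - b"
    "(\<Sum>k\<in>{plain m..<cuts m}. defect (Suc m) A (a' + offset m k) + defect (Suc m) B (b' + offset m k))
      < real_of_int (half_height m) * width (Suc m)"
proof (rule ccontr)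
  let ?\<phi> = "\<lambda>m a b. defect m A a + defect m B b"
  note good = that
  assume no: "\<not> thesis"
  have big: "real_of_int (half_height m) * width (Suc m) \<le>
      (\<Sum>k\<in>{plain m..<cuts m}. ?\<phi> (Suc m) (a' + offset m k) (b' + offset m k))"
    if "n \<le> m" "a' \<in> heights m" "b' \<in> heights m" "a' - b' = a - b" for m a' b'
    using good[OF that] no by (meson not_less)
  \<comment> \<open>Without a good block the \<open>8 * half_height m\<close> special pieces have
    total defect at least \<open>half_height m\<close> widths, an eighth of their measure. So the
    defects are at least an eighth of the part that becomes special within \<open>i\<close>
    stages.\<close>
  have "width m / 8 * (1 - (real m + 4) * (real m + 5) / ((real m + real i + 4) * (real m + real i + 5)))
      \<le> ?\<phi> m a' b'"
    if "n \<le> m" "a' \<in> heights m" "b' \<in> heights m" "a' - b' = a - b" for m i a' b'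
    using that
  proof (induction i arbitrary: m a' b')
    case 0
    then show ?case using defect_nonneg[of m] by (simp add: add_nonneg_nonneg)
  next
    case (Suc i)
    let ?Q = "(real m + real (Suc i) + 4) * (real m + real (Suc i) + 5)"
    let ?w = "width (Suc m)" and ?g = "real_of_int (half_height m)"
    let ?s = "\<lambda>k. ?\<phi> (Suc m) (a' + offset m k) (b' + offset m k)"
    have Q: "0 < ?Q" by (intro mult_pos_pos) auto
    have "?\<phi> m a' b' = (\<Sum>k\<in>{0..<cuts m}. ?s k)"
      using Suc.prems AB by (simp add: defect_split sum.distrib)
    also have "{0..<cuts m} = {0..<plain m} \<union> {plain m..<cuts m}"
      using plain_ge[of m] half_height_ge_1[of m] cuts_eq[of m] by auto
    also have "(\<Sum>k\<in>\<dots>. ?s k) = (\<Sum>k\<in>{0..<plain m}. ?s k) + (\<Sum>k\<in>{plain m..<cuts m}. ?s k)"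
      by (intro sum.union_disjoint) auto
    finally have split: "?\<phi> m a' b' = \<dots>" .
    \<comment> \<open>A common offset preserves the difference of the heights, so the induction
      hypothesis applies to the plain pieces one stage later.\<close>
    have "(\<Sum>k\<in>{0..<plain m}. ?w / 8 * (1 - (real m + 5) * (real m + 6) / ?Q)) \<le> (\<Sum>k\<in>{0..<plain m}. ?s k)"
    proof (rule sum_mono)
      fix k assume "k \<in> {0..<plain m}"
      then have k: "k \<in> {0..<cuts m}" using cuts_eq[of m] half_height_ge_1[of m] by auto
      have "?w / 8 * (1 - (real (Suc m) + 4) * (real (Suc m) + 5) /
          ((real (Suc m) + real i + 4) * (real (Suc m) + real i + 5))) \<le> ?s k"
        using Suc.prems k by (intro Suc.IH offset_heights(1)) auto
      then show "?w / 8 * (1 - (real m + 5) * (real m + 6) / ?Q) \<le> ?s k"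
        by (simp add: algebra_simps del: width.simps)
    qed
    moreover have "(\<Sum>k\<in>{0..<plain m}. ?w / 8 * (1 - (real m + 5) * (real m + 6) / ?Q)) =
        (real m + 4) * (4 * ?g) * (?w / 8 * (1 - (real m + 5) * (real m + 6) / ?Q))"
      using plain_ge[of m] half_height_ge_1[of m] by (simp add: plain_def del: width.simps)
    moreover have "?g * ?w \<le> (\<Sum>k\<in>{plain m..<cuts m}. ?s k)"
      using Suc.prems by (intro big)
    ultimately have "(real m + 4) * (4 * ?g) * (?w / 8 * (1 - (real m + 5) * (real m + 6) / ?Q)) + ?g * ?w
        \<le> ?\<phi> m a' b'"
      using split by linarith
    moreover have "width m / 8 * (1 - (real m + 4) * (real m + 5) / ?Q) =
        (real m + 4) * (4 * ?g) * (?w / 8 * (1 - (real m + 5) * (real m + 6) / ?Q)) + ?g * ?w"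
      unfolding width_Suc[of m] cuts_def using Q
      by (simp add: field_simps del: width.simps)
    ultimately show ?case by (simp only:)
  qed
  \<comment> \<open>After \<open>n + 5\<close> stages at most half of the points have always been
    plain, which yields a total defect of at least \<open>width n / 16\<close>.\<close>
  from this[of n a b "n + 5"] ab
  have "width n / 8 * (1 - (real n + 4) * (real n + 5) / ((2 * real n + 9) * (2 * real n + 10))) \<le> ?\<phi> n a b"
    by (simp add: algebra_simps)
  moreover have "(real n + 4) * (real n + 5) / ((2 * real n + 9) * (2 * real n + 10)) \<le> 1 / 2"
  proof -
    have "0 < (2 * real n + 9) * (2 * real n + 10)" by (intro mult_pos_pos) auto
    then show ?thesis by (simp only: pos_divide_le_eq) (simp add: algebra_simps)
  qed
  then have "width n / 8 * (1 / 2) \<le>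
      width n / 8 * (1 - (real n + 4) * (real n + 5) / ((2 * real n + 9) * (2 * real n + 10)))"
    using width_pos[of n] by (intro mult_left_mono) auto
  ultimately show False using small by simp
qed

lemma offset_first_block:
  assumes "0 \<le> t" "0 \<le> s" "t + s < 4 * half_height n"
  shows "offset n (plain n + (t + s)) = offset n (plain n + t) + s * (8 * half_height n)"
  using assms by (simp add: offset_def special_offset_def algebra_simps)

lemma offset_second_block:
  assumes "0 \<le> t" "0 \<le> s"
  shows "offset n (plain n + 4 * half_height n + (t + s)) = offset n (plain n + 4 * half_height n + t) + s * (8 * half_height n + 1)"
  using assms half_height_ge_1[of n] by (simp add: offset_def special_offset_def algebra_simps)

lemma weak_doubly_ergodic_T: "weak_doubly_ergodic lborel T"
  unfolding weak_doubly_ergodic_def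
proof (intro ballI impI)
  fix A B :: "real set"
  assume "A \<in> sets lborel" "B \<in> sets lborel" and pos: "0 < emeasure lborel A" "0 < emeasure lborel B"
  then have AB: "A \<in> sets borel" "B \<in> sets borel" by auto
  have "\<forall>\<^sub>F n in sequentially. (\<exists>a\<in>heights n. measure lborel (level n a - A) < 1 / 32 * width n) \<and>
      (\<exists>b\<in>heights n. measure lborel (level n b - B) < 1 / 32 * width n)"
    using AB pos by (intro eventually_conj eventually_dense_level) auto
  then obtain n a b where ab: "a \<in> heights n" "b \<in> heights n"
    and "defect n A a < 1 / 32 * width n" "defect n B b < 1 / 32 * width n"
    by (auto simp: eventually_sequentially defect_def)
  then have "defect n A a + defect n B b < width n / 16" by simp
  then obtain m a' b' where m: "n \<le> m" "a' \<in> heights m" "b' \<in> heights m" "a' - b' = a - b"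
    and sum: "(\<Sum>k\<in>{plain m..<cuts m}. defect (Suc m) A (a' + offset m k) + defect (Suc m) B (b' + offset m k))
      < real_of_int (half_height m) * width (Suc m)"
    using ex_good_block[OF AB ab] by blast
  let ?L = "4 * half_height m" and ?w = "width (Suc m)"
  define DA where "DA k0 = (\<Sum>t\<in>{0..<?L}. defect (Suc m) A (a' + offset m (k0 + t)))" for k0
  define DB where "DB k0 = (\<Sum>t\<in>{0..<?L}. defect (Suc m) B (b' + offset m (k0 + t)))" for k0
  have g: "1 \<le> half_height m" by (rule half_height_ge_1)
  \<comment> \<open>Each half of the special pieces inherits the bound for the whole, since defects
    are nonnegative.\<close>
  have D: "DA k0 + DB k0 < half_height m * ?w" "0 \<le> DA k0" "0 \<le> DB k0"
    if "k0 = plain m \<or> k0 = plain m + 4 * half_height m" for k0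
  proof -
    have "DA k0 + DB k0 = (\<Sum>k\<in>{k0..<k0 + ?L}. defect (Suc m) A (a' + offset m k) + defect (Suc m) B (b' + offset m k))"
      unfolding DA_def DB_def sum.distrib[symmetric]
      by (rule sum.reindex_bij_witness[of _ "\<lambda>k. k - k0" "\<lambda>t. k0 + t"]) auto
    also have "\<dots> \<le> (\<Sum>k\<in>{plain m..<cuts m}. defect (Suc m) A (a' + offset m k) + defect (Suc m) B (b' + offset m k))"
      using that g cuts_eq[of m] by (intro sum_mono2) (auto intro: add_nonneg_nonneg defect_nonneg)
    finally show "DA k0 + DB k0 < half_height m * ?w" using sum by simp
    show "0 \<le> DA k0" "0 \<le> DB k0" by (auto simp: DA_def DB_def intro: sum_nonneg defect_nonneg)
  qed
  \<comment> \<open>A shift by at most \<open>2 * half_height m\<close> pieces leaves at least half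
    of the \<open>4 * half_height m\<close> pieces of a block, and two sums below
    \<open>half_height m * ?w\<close> fit under that.\<close>
  have bound: "x < real_of_int (?L - s) * ?w" if "x < 2 * (half_height m * ?w)" "s \<le> 2 * half_height m" for x s
  proof -
    have "real_of_int (2 * half_height m) * ?w \<le> real_of_int (?L - s) * ?w"
      using that(2) width_pos[of "Suc m"] by (intro mult_right_mono) (auto simp del: of_int_mult of_int_diff)
    then show ?thesis using that(1) by simp
  qed
  note D1 = D[of "plain m"] and D2 = D[of "plain m + 4 * half_height m"]
  have r1: "plain m + t \<in> {0..<cuts m}" if "t \<in> {0..<?L}" for t
    using that g plain_ge[of m] cuts_eq[of m] by auto
  have r2: "plain m + 4 * half_height m + t \<in> {0..<cuts m}" if "t \<in> {0..<?L}" for t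
    using that g plain_ge[of m] cuts_eq[of m] by auto
  have w: "0 \<le> half_height m * ?w" using g width_pos[of "Suc m"] by (intro mult_nonneg_nonneg) auto
  have AA1: "0 < emeasure lborel (A \<inter> (T ^^ d) -` A)"
    if s: "0 \<le> s" "s \<le> 2 * half_height m" and d: "int d = s * (8 * half_height m)" for s d
  proof -
    have "DA (plain m) + DA (plain m) < real_of_int (?L - s) * ?w"
      using D1 w s by (intro bound) auto
    note * = this[unfolded DA_def DA_def]
    have d': "int d = a' - a' + s * (8 * half_height m)" using d by simp
    show ?thesis
      using s(1) by (intro block_meets[OF m(2) m(2) AB(1) AB(1) r1 _ s(1) d' *] offset_first_block) auto
  qed
  have AA2: "0 < emeasure lborel (A \<inter> (T ^^ d) -` A)"
    if s: "0 \<le> s" "s \<le> 2 * half_height m" and d: "int d = s * (8 * half_height m + 1)" for s d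
  proof -
    have "DA (plain m + 4 * half_height m) + DA (plain m + 4 * half_height m) < real_of_int (?L - s) * ?w"
      using D2 w s by (intro bound) auto
    note * = this[unfolded DA_def DA_def]
    have d': "int d = a' - a' + s * (8 * half_height m + 1)" using d by simp
    show ?thesis
      using s(1) by (intro block_meets[OF m(2) m(2) AB(1) AB(1) r2 _ s(1) d' *] offset_second_block) auto
  qed
  have BA1: "0 < emeasure lborel (B \<inter> (T ^^ d) -` A)"
    if s: "0 \<le> s" "s \<le> 2 * half_height m" and d: "int d = a' - b' + s * (8 * half_height m)" for s d
  proof -
    have "DA (plain m) + DB (plain m) < real_of_int (?L - s) * ?w"
      using D1 w s by (intro bound) auto
    note * = this[unfolded DB_def DA_def]
    have d': "int d = a' - b' + s * (8 * half_height m)" using d by simp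
    show ?thesis
      using s(1) by (intro block_meets[OF m(2) m(3) AB(1) AB(2) r1 _ s(1) d' *] offset_first_block) auto
  qed
  have BA2: "0 < emeasure lborel (B \<inter> (T ^^ d) -` A)"
    if s: "0 \<le> s" "s \<le> 2 * half_height m" and d: "int d = a' - b' + s * (8 * half_height m + 1)" for s d
  proof -
    have "DA (plain m + 4 * half_height m) + DB (plain m + 4 * half_height m) < real_of_int (?L - s) * ?w"
      using D2 w s by (intro bound) auto
    note * = this[unfolded DB_def DA_def]
    have d': "int d = a' - b' + s * (8 * half_height m + 1)" using d by simp
    show ?thesis
      using s(1) by (intro block_meets[OF m(2) m(3) AB(1) AB(2) r2 _ s(1) d' *] offset_second_block) auto
  qed
  define j where "j = a' - b'"
  have j: "\<bar>j\<bar> \<le> 2 * half_height m" using m(2,3) by (auto simp: j_def heights_def)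
  \<comment> \<open>One \<open>d\<close> must serve both intersections. A height difference
    \<open>j > 0\<close> is the gain of \<open>j\<close> steps in the second half over
    \<open>j\<close> steps in the first. For \<open>j < 0\<close> the halves exchange their roles,
    and for \<open>j = 0\<close> one step in the first half does both.\<close>
  have "\<exists>d>0. 0 < emeasure lborel (A \<inter> (T ^^ d) -` A) \<and> 0 < emeasure lborel (B \<inter> (T ^^ d) -` A)"
  proof -
    consider "0 < j" | "j = 0" | "j < 0" by linarith
    then show ?thesis
    proof cases
      case 1
      have "0 < j * (8 * half_height m + 1)" using 1 g by (intro mult_pos_pos) auto
      then show ?thesis using 1 j
        by (intro exI[of _ "nat (j * (8 * half_height m + 1))"] conjI AA2[of j] BA1[of j])
          (auto simp: j_def[symmetric] algebra_simps)
    next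
      case 2
      then show ?thesis using j g
        by (intro exI[of _ "nat (8 * half_height m)"] conjI AA1[of 1] BA1[of 1])
          (auto simp: j_def[symmetric])
    next
      case 3
      have "0 < (- j) * (8 * half_height m)" using 3 g by (intro mult_pos_pos) auto
      then show ?thesis using 3 j
        by (intro exI[of _ "nat ((- j) * (8 * half_height m))"] conjI AA1[of "- j"] BA2[of "- j"])
          (auto simp: j_def[symmetric] algebra_simps)
    qed
  qed
  then show "\<exists>n>0. 0 < emeasure lborel (A \<inter> ((T ^^ n) -` A \<inter> space lborel)) \<and>
      0 < emeasure lborel (B \<inter> ((T ^^ n) -` A \<inter> space lborel))" by simp
qed

section \<open>The Cartesian square is not ergodic\<close>

definition good_differences :: "nat \<Rightarrow> int set" where
  "good_differences n = {offset n k - offset n l | k l.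
     k \<in> {0..<cuts n} \<and> l \<in> {0..<cuts n} \<and> (k < plain n \<or> l < plain n)}"

text \<open>\<open>diagonal_differences n\<close> collects the height differences in column \<open>n\<close> of good pairs that
  start in the same level of column \<open>0\<close>.\<close>

primrec diagonal_differences :: "nat \<Rightarrow> int set" where
  "diagonal_differences 0 = {0}"
| "diagonal_differences (Suc n) = {D + d | D d. D \<in> diagonal_differences n \<and> d \<in> good_differences n}"

text \<open>Asking for membership only at late stages makes the set invariant: \<open>T\<close>
  raises both heights by 1 as soon as both points are inside the column.\<close>

definition diagonal_part :: "(real \<times> real) set" where
  "diagonal_part = {p. \<forall>\<^sub>F n in sequentially.
     height n (fst p) - height n (snd p) \<in> diagonal_differences n}"

lemma diagonal_differences_bound: "D \<in> diagonal_differences n \<Longrightarrow> \<bar>D\<bar> < 2 * half_height n"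
proof (induction n arbitrary: D)
  case (Suc n)
  then obtain D' k l where D: "D = D' + (offset n k - offset n l)" "D' \<in> diagonal_differences n"
    "k \<in> {0..<cuts n}" "l \<in> {0..<cuts n}" by (auto simp: good_differences_def)
  then show ?case
    using Suc.IH[of D'] offset_bounds[of k n] offset_bounds[of l n] by linarith
qed simp

lemma good_differences_eq:
  assumes "d \<in> good_differences n" "d' \<in> good_differences n" "\<bar>d - d'\<bar> < 4 * half_height n"
  shows "d = d'"
proof -
  obtain k l k' l' where "d = offset n k - offset n l" "d' = offset n k' - offset n l'"
    "k \<in> {0..<cuts n}" "l \<in> {0..<cuts n}" "k' \<in> {0..<cuts n}" "l' \<in> {0..<cuts n}"
    "k < plain n \<or> l < plain n" "k' < plain n \<or> l' < plain n"
    using assms(1,2) unfolding good_differences_def by blast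
  then show ?thesis using good_difference_eq[of k n l k' l'] assms(3) by simp
qed

text \<open>The difference at stage \<open>Suc n\<close> has two decompositions into a height
  difference of absolute value below \<open>2 * half_height n\<close> and a good difference. The
  good differences are then within \<open>4 * half_height n\<close> of each other, hence
  equal.\<close>

lemma height_difference_descend:
  assumes x: "cell n x \<in> heights n" "cell n y \<in> heights n"
    and good: "digit n x < plain n \<or> digit n y < plain n"
    and D: "height (Suc n) x - height (Suc n) y \<in> diagonal_differences (Suc n)"
  shows "height n x - height n y \<in> diagonal_differences n"
proof -
  let ?d = "offset n (digit n x) - offset n (digit n y)"
  have g: "?d \<in> good_differences n" using good digit_range unfolding good_differences_def by blast
  obtain D' d' where D': "height (Suc n) x - height (Suc n) y = D' + d'"
    "D' \<in> diagonal_differences n" "d' \<in> good_differences n" using D by auto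
  have e: "height n x - height n y + ?d = D' + d'"
    using D'(1) height_Suc[OF x(1)] height_Suc[OF x(2)] by simp
  have "\<bar>height n x - height n y\<bar> < 2 * half_height n"
    using height_in_heights[OF x(1)] height_in_heights[OF x(2)] by (auto simp: heights_def)
  then have "\<bar>?d - d'\<bar> < 4 * half_height n" using diagonal_differences_bound[OF D'(2)] e by linarith
  then have "?d = d'" using good_differences_eq[OF g D'(3)] by simp
  then show ?thesis using e D'(2) by simp
qed

definition special_set :: "nat \<Rightarrow> real set" where
  "special_set n = {x. plain n \<le> digit n x}"

text \<open>Pairs whose coordinates are never special at the same stage. For them the height
  difference can be traced both up from column 0 and back down to it.\<close>

definition good_pairs :: "int \<Rightarrow> int \<Rightarrow> (real \<times> real) set" where
  "good_pairs f g = level 0 f \<times> level 0 g - (\<Union>n. special_set n \<times> special_set n)"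

lemma good_pairs_D:
  assumes "(x, y) \<in> good_pairs f g"
  shows "cell n x \<in> heights n" "cell n y \<in> heights n" "digit n x < plain n \<or> digit n y < plain n"
    "height 0 x = f" "height 0 y = g"
  using assms cell_in_heights_mono[of 0 x n] cell_in_heights_mono[of 0 y n]
  by (auto simp: good_pairs_def level_def special_set_def not_le)

lemma good_pairs_subset_diagonal_part: "good_pairs f f \<subseteq> diagonal_part"
proof
  fix p assume p: "p \<in> good_pairs f f"
  obtain x y where xy: "p = (x, y)" by (cases p)
  note P = good_pairs_D[OF p[unfolded xy]]
  have "height n x - height n y \<in> diagonal_differences n" for n
  proof (induction n)
    case (Suc n)
    have "offset n (digit n x) - offset n (digit n y) \<in> good_differences n"
      using P(3)[of n] digit_range unfolding good_differences_def by blast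
    moreover have "height (Suc n) x - height (Suc n) y =
        (height n x - height n y) + (offset n (digit n x) - offset n (digit n y))"
      using height_Suc[OF P(1)] height_Suc[OF P(2)] by simp
    ultimately show ?case using Suc by auto
  qed (use P in auto)
  then show "p \<in> diagonal_part" by (simp add: diagonal_part_def xy)
qed

lemma good_pairs_disjoint_diagonal_part:
  assumes "f \<noteq> g"
  shows "good_pairs f g \<inter> diagonal_part = {}"
proof (rule equals0I)
  fix p assume p: "p \<in> good_pairs f g \<inter> diagonal_part"
  obtain x y where xy: "p = (x, y)" by (cases p)
  have pp: "(x, y) \<in> good_pairs f g" using p xy by simp
  note P = good_pairs_D[OF pp]
  obtain m where "height m x - height m y \<in> diagonal_differences m"
    using p xy by (auto simp: diagonal_part_def eventually_sequentially)
  \<comment> \<open>Descending stage by stage leads to column 0, where the only diagonal difference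
    is 0.\<close>
  then have "height 0 x - height 0 y \<in> diagonal_differences 0"
    by (induction m) (use P height_difference_descend in blast)+
  then show False using P(4,5) assms by simp
qed

lemma diagonal_part_invariant: "map_prod T T -` diagonal_part = diagonal_part"
proof (intro set_eqI)
  fix p :: "real \<times> real"
  obtain x y where xy: "p = (x, y)" by (cases p)
  have "\<forall>\<^sub>F n in sequentially. height n (T x) - height n (T y) = height n x - height n y"
    using eventually_inside[of x] eventually_inside[of y]
    by eventually_elim (simp add: height_T)
  then have "(\<forall>\<^sub>F n in sequentially. height n (T x) - height n (T y) \<in> diagonal_differences n) \<longleftrightarrow>
      (\<forall>\<^sub>F n in sequentially. height n x - height n y \<in> diagonal_differences n)"
    by (intro eventually_cong refl) (auto elim: eventually_mono)
  then show "p \<in> map_prod T T -` diagonal_part \<longleftrightarrow> p \<in> diagonal_part"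
    by (simp add: diagonal_part_def xy)
qed

section \<open>Measurability and positive measure of the good pairs\<close>

lemma cell_measurable [measurable]: "cell n \<in> borel \<rightarrow>\<^sub>M count_space UNIV"
  unfolding cell_def by measurable

lemma height_measurable [measurable]: "height n \<in> borel \<rightarrow>\<^sub>M count_space UNIV"
  unfolding height_def by measurable

lemma special_set_borel [measurable]: "special_set n \<in> sets borel"
proof -
  have "special_set n = cell (Suc n) -` {i. plain n \<le> i mod cuts n}"
    by (auto simp: special_set_def digit_def)
  also have "\<dots> \<in> sets borel" by (rule measurable_sets_borel[OF cell_measurable]) simp
  finally show ?thesis .
qed

lemma diagonal_part_sets: "diagonal_part \<in> sets (lborel \<Otimes>\<^sub>M lborel)"
proof -
  have "{p. height n (fst p) - height n (snd p) \<in> diagonal_differences n} \<in> sets (lborel \<Otimes>\<^sub>M lborel)" for n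
  proof -
    have "{p. height n (fst p) - height n (snd p) \<in> diagonal_differences n} =
        (\<Union>(i, j)\<in>{(i, j). i - j \<in> diagonal_differences n}. (height n -` {i}) \<times> (height n -` {j}))"
      by auto
    also have "\<dots> \<in> sets (lborel \<Otimes>\<^sub>M lborel)"
      using measurable_sets_borel[OF height_measurable]
      by (intro sets.countable_UN' countableI_type) auto
    finally show ?thesis .
  qed
  then have "(\<Union>m. \<Inter>n\<in>{m..}. {p. height n (fst p) - height n (snd p) \<in> diagonal_differences n})
      \<in> sets (lborel \<Otimes>\<^sub>M lborel)"
    by (intro sets.countable_UN'' sets.countable_INT') auto
  also have "(\<Union>m. \<Inter>n\<in>{m..}. {p. height n (fst p) - height n (snd p) \<in> diagonal_differences n})
      = diagonal_part"
    by (auto simp: diagonal_part_def eventually_sequentially)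
  finally show ?thesis .
qed

lemma level_Int_special_set:
  assumes f: "f \<in> heights n"
  shows "level n f \<inter> special_set n = (\<Union>k\<in>{plain n..<cuts n}. level (Suc n) (f + offset n k))"
proof (intro equalityI subsetI)
  fix x assume "x \<in> level n f \<inter> special_set n"
  then show "x \<in> (\<Union>k\<in>{plain n..<cuts n}. level (Suc n) (f + offset n k))"
    using cell_Suc[of n x] height_Suc[of n x] digit_range[of n x]
    by (auto simp: level_def special_set_def)
next
  fix x assume "x \<in> (\<Union>k\<in>{plain n..<cuts n}. level (Suc n) (f + offset n k))"
  then obtain k where k: "k \<in> {plain n..<cuts n}" "x \<in> level (Suc n) (f + offset n k)" by blast
  have kc: "k \<in> {0..<cuts n}" using k(1) plain_ge[of n] half_height_ge_1[of n] by auto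
  have x: "x \<in> level n f" using k kc level_split[OF f] by blast
  then have "height n x = f" "cell n x \<in> heights n" by (auto simp: level_def)
  then have "digit n x = k"
    using k(2) height_Suc[of n x] offset_inj[OF f f digit_range kc] by (auto simp: level_def)
  then show "x \<in> level n f \<inter> special_set n" using x k by (simp add: special_set_def)
qed

text \<open>All levels of a column are cut in the same way, so being special at a later stage is
  independent of the level occupied now.\<close>

lemma measure_level_special:
  assumes "f \<in> heights m"
  shows "measure lborel (level m f \<inter> special_set (m + i)) = width m * (2 / (real (m + i) + 6))"
  using assms
proof (induction i arbitrary: m f)
  case 0
  have sub: "k \<in> {0..<cuts m}" if "k \<in> {plain m..<cuts m}" for k
    using that plain_ge[of m] half_height_ge_1[of m] by auto
  have "measure lborel (level m f \<inter> special_set m) =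
      (\<Sum>k\<in>{plain m..<cuts m}. measure lborel (level (Suc m) (f + offset m k)))"
    unfolding level_Int_special_set[OF 0]
  proof (rule measure_UNION')
    show "pairwise (\<lambda>k l. disjnt (level (Suc m) (f + offset m k)) (level (Suc m) (f + offset m l)))
        {plain m..<cuts m}"
      using offset_inj[OF 0 0 sub sub] by (fastforce simp: pairwise_def disjnt_def level_def)
  qed (use sub 0 in \<open>auto intro!: level_fmeasurable offset_heights(1)\<close>)
  also have "\<dots> = (\<Sum>k\<in>{plain m..<cuts m}. width (Suc m))"
    using sub 0 by (intro sum.cong refl measure_level offset_heights(1)) auto
  also have "\<dots> = 8 * half_height m * width (Suc m)"
    using half_height_ge_1[of m] by (simp add: cuts_eq del: width.simps)
  also have "\<dots> = width m * (2 / (real m + 6))"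
    unfolding width_Suc[of m] cuts_def by (simp add: field_simps del: width.simps)
  finally show ?case by simp
next
  case (Suc i)
  have "level m f \<inter> special_set (m + Suc i) =
      (\<Union>k\<in>{0..<cuts m}. level (Suc m) (f + offset m k) \<inter> special_set (m + Suc i))"
    using level_split[OF Suc.prems] by blast
  also have "measure lborel \<dots> =
      (\<Sum>k\<in>{0..<cuts m}. measure lborel (level (Suc m) (f + offset m k) \<inter> special_set (m + Suc i)))"
  proof (rule measure_UNION')
    show "pairwise (\<lambda>k l. disjnt (level (Suc m) (f + offset m k) \<inter> special_set (m + Suc i))
        (level (Suc m) (f + offset m l) \<inter> special_set (m + Suc i))) {0..<cuts m}"
      using offset_inj[OF Suc.prems Suc.prems] by (fastforce simp: pairwise_def disjnt_def level_def)
    show "level (Suc m) (f + offset m k) \<inter> special_set (m + Suc i) \<in> fmeasurable lborel"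
      if "k \<in> {0..<cuts m}" for k
      using that Suc.prems by (intro fmeasurable_Int_fmeasurable level_fmeasurable offset_heights(1)) auto
  qed simp
  also have "\<dots> = (\<Sum>k\<in>{0..<cuts m}. width (Suc m) * (2 / (real (m + Suc i) + 6)))"
  proof (intro sum.cong refl)
    fix k assume "k \<in> {0..<cuts m}"
    then show "measure lborel (level (Suc m) (f + offset m k) \<inter> special_set (m + Suc i)) =
        width (Suc m) * (2 / (real (m + Suc i) + 6))"
      using Suc.IH[OF offset_heights(1)[OF Suc.prems]] by (simp del: width.simps)
  qed
  also have "\<dots> = width m * (2 / (real (m + Suc i) + 6))"
    using cuts_pos[of m] by simp
  finally show ?case .
qed

lemma good_pairs_sets: "f \<in> heights 0 \<Longrightarrow> g \<in> heights 0 \<Longrightarrow> good_pairs f g \<in> sets (lborel \<Otimes>\<^sub>M lborel)"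
  unfolding good_pairs_def by (intro sets.Diff sets.countable_UN'' pair_measureI) auto

text \<open>The product of two levels of column 0 has measure 1, while the pairs that are special
  together at some stage have measure at most \<open>4 / 5\<close>.\<close>

lemma good_pairs_not_null:
  assumes f: "f \<in> heights 0" "g \<in> heights 0"
  shows "good_pairs f g \<notin> null_sets (lborel \<Otimes>\<^sub>M lborel)"
proof
  let ?M = "lborel \<Otimes>\<^sub>M lborel :: (real \<times> real) measure"
  assume null: "good_pairs f g \<in> null_sets ?M"
  define Bad where "Bad n = (level 0 f \<inter> special_set n) \<times> (level 0 g \<inter> special_set n)" for n
  have es: "emeasure lborel (level 0 h \<inter> special_set n) = ennreal (2 / (real n + 6))" if "h \<in> heights 0" for h n
  proof -
    have "level 0 h \<inter> special_set n \<in> fmeasurable lborel"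
      using that by (intro fmeasurable_Int_fmeasurable level_fmeasurable) auto
    then show ?thesis
      using measure_level_special[OF that, of n] by (simp add: emeasure_eq_measure2)
  qed
  have Bad: "emeasure ?M (Bad n) \<le> ennreal (4 / (real n + 5) - 4 / (real (Suc n) + 5))" for n
  proof -
    have "emeasure ?M (Bad n) = ennreal (2 / (real n + 6)) * ennreal (2 / (real n + 6))"
      unfolding Bad_def using f es by (subst lborel.emeasure_pair_measure_Times) auto
    also have "\<dots> = ennreal (2 / (real n + 6) * (2 / (real n + 6)))"
      by (rule ennreal_mult[symmetric]) auto
    also have "\<dots> = ennreal (4 / ((real n + 6) * (real n + 6)))" by simp
    \<comment> \<open>Enlarging one factor turns the squares of the proportions into a telescoping
      series with sum \<open>4 / 5\<close>.\<close>
    also have "\<dots> \<le> ennreal (4 / ((real n + 5) * (real n + 6)))"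
      by (intro ennreal_leI divide_left_mono mult_right_mono mult_pos_pos) auto
    also have "4 / ((real n + 5) * (real n + 6)) = 4 / (real n + 5) - 4 / (real (Suc n) + 5)"
      by (simp add: field_simps)
    finally show ?thesis .
  qed
  have Bads: "Bad n \<in> sets ?M" for n unfolding Bad_def using f by (intro pair_measureI) auto
  have lim: "(\<lambda>n. 4 / (real n + 5)) \<longlonglongrightarrow> 0"
  proof -
    have "(\<lambda>n. 4 / (5 + real n)) \<longlonglongrightarrow> 0"
      by (intro tendsto_divide_0[OF tendsto_const] filterlim_at_top_imp_at_infinity
          filterlim_tendsto_add_at_top[OF tendsto_const] filterlim_real_sequentially)
    then show ?thesis by (simp add: add.commute)
  qed
  have "1 = emeasure ?M (level 0 f \<times> level 0 g)"
    using f by (subst lborel.emeasure_pair_measure_Times) (auto simp: emeasure_level)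
  also have "\<dots> \<le> emeasure ?M ((\<Union>n. Bad n) \<union> good_pairs f g)"
    using f Bads null by (intro emeasure_mono sets.Un sets.countable_UN'') (auto simp: good_pairs_def Bad_def)
  also have "\<dots> = emeasure ?M (\<Union>n. Bad n)"
    using null Bads by (intro emeasure_Un_null_set) auto
  also have "\<dots> \<le> (\<Sum>n. emeasure ?M (Bad n))"
    using Bads by (intro emeasure_subadditive_countably) auto
  also have "\<dots> \<le> (\<Sum>n. ennreal (4 / (real n + 5) - 4 / (real (Suc n) + 5)))"
    using Bad by (intro suminf_le) auto
  also have "\<dots> = ennreal (4 / (real 0 + 5) - 0)"
    using telescope_sums'[OF lim] by (intro suminf_ennreal_eq) (auto simp: field_simps)
  also have "\<dots> < ennreal 1" by (subst ennreal_less_iff) auto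
  finally show False by simp
qed

text \<open>The heights 0 and -1 are the two levels of column 0. The invariant set contains the good
  pairs that start in the same level, its complement contains those that start in different levels,
  and neither family is null.\<close>

lemma not_ergodic_square: "\<not> ergodic (lborel \<Otimes>\<^sub>M lborel) (map_prod T T)"
proof
  let ?M = "lborel \<Otimes>\<^sub>M lborel :: (real \<times> real) measure"
  assume "ergodic ?M (map_prod T T)"
  then have "diagonal_part \<in> null_sets ?M \<or> space ?M - diagonal_part \<in> null_sets ?M"
    using diagonal_part_sets diagonal_part_invariant by (auto simp: ergodic_def space_pair_measure)
  moreover have h: "0 \<in> heights 0" "- 1 \<in> heights 0" by (auto simp: heights_def)
  ultimately consider "good_pairs 0 0 \<in> null_sets ?M" | "good_pairs 0 (- 1) \<in> null_sets ?M"
    using null_sets_subset[OF _ good_pairs_sets[OF h(1) h(1)] good_pairs_subset_diagonal_part]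
      null_sets_subset[OF _ good_pairs_sets[OF h(1) h(2)], of "space ?M - diagonal_part"]
      good_pairs_disjoint_diagonal_part[of 0 "- 1"]
    by (auto simp: space_pair_measure)
  then show False using good_pairs_not_null h by cases auto
qed

section \<open>The underlying measure space\<close>

lemma standard_borel_lborel: "standard_borel (lborel :: real measure)"
proof -
  have "separable_space (euclidean :: real topology)"
    unfolding separable_space_def
    by (intro exI[of _ "\<rat>"]) (simp add: countable_rat Rats_closure_real)
  then show ?thesis
    unfolding standard_borel_def
    by (intro exI[of _ euclidean]) (auto simp: completely_metrizable_space_euclidean borel_def)
qed

text \<open>A late level of width below the measure of \<open>A\<close> that is not almost disjoint
  from \<open>A\<close> cuts out a smaller part of positive measure.\<close>

lemma nonatomic_lborel: "nonatomic (lborel :: real measure)"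
  unfolding nonatomic_def
proof (intro ballI impI)
  fix A :: "real set" assume "A \<in> sets lborel" and pos: "0 < emeasure lborel A"
  then have A: "A \<in> sets borel" by simp
  obtain y where y: "0 < y" "y < emeasure lborel A" using dense[OF pos] by blast
  then obtain r where r: "y = ennreal r" "0 \<le> r" by (cases y) auto
  have "0 < r" using y r by simp
  then have "\<forall>\<^sub>F n in sequentially. width n < r" using order_tendstoD(2)[OF width_tendsto_0] by blast
  moreover have "\<forall>\<^sub>F n in sequentially. \<exists>f\<in>heights n. measure lborel (level n f - A) < 1 * width n"
    by (rule eventually_dense_level[OF A pos]) simp
  ultimately have "\<forall>\<^sub>F n in sequentially. width n < r \<and>
      (\<exists>f\<in>heights n. measure lborel (level n f - A) < width n)"
    by eventually_elim simp
  then obtain n f where n: "width n < r" and f: "f \<in> heights n" "measure lborel (level n f - A) < width n"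
    by (auto simp: eventually_sequentially)
  have "emeasure lborel (A \<inter> level n f) \<noteq> 0"
  proof
    assume "emeasure lborel (A \<inter> level n f) = 0"
    then have "A \<inter> level n f \<in> null_sets lborel" using A f by (intro null_setsI) auto
    then have "emeasure lborel (level n f - (A \<inter> level n f)) = emeasure lborel (level n f)"
      using f by (intro emeasure_Diff_null_set) auto
    moreover have "level n f - (A \<inter> level n f) = level n f - A" by auto
    ultimately have "measure lborel (level n f - A) = measure lborel (level n f)" by (simp add: measure_def)
    then show False using f by (simp add: measure_level)
  qed
  moreover have "emeasure lborel (A \<inter> level n f) \<le> emeasure lborel (level n f)"
    using f by (intro emeasure_mono) auto
  then have "emeasure lborel (A \<inter> level n f) \<le> ennreal (width n)" using f by (simp add: emeasure_level)
  then have "emeasure lborel (A \<inter> level n f) < emeasure lborel A"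
    using ennreal_lessI[OF \<open>0 < r\<close> n] y(2) r(1) by simp
  ultimately show "\<exists>B\<in>sets lborel. B \<subseteq> A \<and> 0 < emeasure lborel B \<and> emeasure lborel B < emeasure lborel A"
    using A f by (intro bexI[of _ "A \<inter> level n f"]) (auto simp: zero_less_iff_neq_zero)
qed

theorem theorem6p5:
  shows "\<exists>(M :: real measure) (T :: real \<Rightarrow> real).
    standard_borel M \<and> sigma_finite_measure M \<and> nonatomic M \<and> emeasure M (space M) = \<infinity> \<and>
    invertible_measure_preserving M T \<and>
    rigid M T \<and> weak_doubly_ergodic M T \<and>
    \<not> ergodic (M \<Otimes>\<^sub>M M) (map_prod T T)"
proof (intro exI conjI)
  show "emeasure lborel (space (lborel :: real measure)) = \<infinity>" by (simp add: emeasure_lborel_UNIV)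
qed (rule standard_borel_lborel sigma_finite_lborel nonatomic_lborel invertible_measure_preserving_T
  rigid_T weak_doubly_ergodic_T not_ergodic_square)+

end
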